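(* Let $k\ge 2$ be an integer and let $I_k$ be a nonempty subset of $\{1,\dots,k-1\}$. For a ratio $r>0$, let $X_\delta$ denote the number of $\delta$-solutions of a random instance $I_k(\lfloor rn\rfloor,n)$. Then there exist a real $r^*_{I_k}>0$ and a real $0<\delta<1$ such that for every $0<r<r^*_{I_k}$, \[ \lim_{n\to\infty}\frac{\mathbf{E}[X_\delta]^2}{\mathbf{E}[X_\delta^2]}>0 . \]
   Context: Problem $CSP(I_k)$: given $n$ boolean variables $x_1,\dots,x_n$, a constraint is a $k$-tuple of variables $(x_{i_1},\dots,x_{i_k})$; it is satisfied by an assignment $\sigma:\{x_1,\dots,x_n\}\to\{0,1\}$ iff the number of coordinates $j$ with $\sigma(x_{i_j})=1$ belongs to $I_k$. An instance (a conjunction of constraints) is satisfied by $\sigma$ iff every constraint is satisfied. Random model: $I_k(m,n)$ is the random instance on $n$ variables formed by drawing $m$ constraints independently, uniformly at random and with replacement, each constraint being a uniformly random ordered $k$-tuple of the $n$ variables. For $\delta\in[0,1]$, a $\delta$-valuation is an assignment with exactly $\lfloor\delta n\rfloor$ variables equal to $1$; a $\delta$-solution of an instance is a $\delta$-valuation satisfying it. *)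

theory Defs
  imports "HOL-Probability.Probability"
begin

text \<open>Variables x_1..x_n are represented by 0..n-1. A constraint is an ordered
k-tuple of variables, i.e. a list of length k with entries < n.
An instance with m constraints is a list of m constraints.\<close>

definition constraints :: "nat \<Rightarrow> nat \<Rightarrow> nat list set" where
  "constraints k n = {c. length c = k \<and> set c \<subseteq> {..<n}}"

definition instances :: "nat \<Rightarrow> nat \<Rightarrow> nat \<Rightarrow> nat list list set" where
  "instances k m n = {F. length F = m \<and> set F \<subseteq> constraints k n}"

text \<open>Random model I_k(m,n): m independent uniform constraints = uniform instance.\<close>
definition random_instance :: "nat \<Rightarrow> nat \<Rightarrow> nat \<Rightarrow> nat list list pmf" where
  "random_instance k m n = pmf_of_set (instances k m n)"

text \<open>An assignment is represented by the set S of variables set to 1.\<close>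
definition sat_constraint :: "nat set \<Rightarrow> nat set \<Rightarrow> nat list \<Rightarrow> bool" where
  "sat_constraint I S c \<longleftrightarrow> card {j. j < length c \<and> c ! j \<in> S} \<in> I"

definition sat_instance :: "nat set \<Rightarrow> nat set \<Rightarrow> nat list list \<Rightarrow> bool" where
  "sat_instance I S F \<longleftrightarrow> (\<forall>c\<in>set F. sat_constraint I S c)"

definition delta_valuations :: "real \<Rightarrow> nat \<Rightarrow> nat set set" where
  "delta_valuations \<delta> n = {S. S \<subseteq> {..<n} \<and> card S = nat \<lfloor>\<delta> * real n\<rfloor>}"

definition num_delta_solutions :: "nat set \<Rightarrow> real \<Rightarrow> nat \<Rightarrow> nat list list \<Rightarrow> nat" where
  "num_delta_solutions I \<delta> n F = card {S \<in> delta_valuations \<delta> n. sat_instance I S F}"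

end

theory Submission
  imports Defs "HOL-Real_Asymp.Real_Asymp"
begin

text \<open>
  Write \<open>s = \<lfloor>\<delta>n\<rfloor>\<close>, \<open>x = s/n\<close>. Grouping pairs of valuations by their overlap \<open>t\<close>, the ratio in question equals
  \<open>(\<Sum>t. h t) / (\<Sum>t. h t * (Q t / p\<^sup>2) ^ m)\<close>, where \<open>h\<close> is the (unnormalised) hypergeometric weight, \<open>p\<close> is the
  probability that one valuation satisfies a random constraint and \<open>Q t\<close> the probability that two valuations
  with overlap \<open>t\<close> both do. As a polynomial in the correlation \<open>z = t/n - x\<^sup>2\<close>, \<open>Q\<close> has constant term \<open>p\<^sup>2\<close> and
  linear coefficient \<open>p'(x)\<^sup>2 / k\<close>. Since \<open>p\<close> vanishes at 0 and 1, it has an interior maximum \<open>\<delta>\<close>, and there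
  the linear term is negligible.

  On the scale \<open>t = mode + u \<surd>n\<close> the weights \<open>h t / h mode\<close> tend to \<open>exp (-u\<^sup>2 / (2 \<delta>\<^sup>2 (1-\<delta>)\<^sup>2))\<close> and
  \<open>(Q t / p\<^sup>2) ^ m\<close> tends to \<open>exp (r \<beta> u\<^sup>2)\<close>. The weights have a uniform Gaussian tail, which for small \<open>r\<close>
  dominates the second factor; by dominated convergence both sums divided by \<open>\<surd>n h mode\<close> converge to positive
  Gaussian integrals. Normalising by \<open>h mode\<close> makes the ratios \<open>h (t + 1) / h t\<close> the only input about \<open>h\<close>, so
  Stirling's formula is not needed.
\<close>

section \<open>Probability that a random constraint is satisfied\<close>

text \<open>\<open>(avg x ^^ k) f 0\<close> is the expectation of \<open>f\<close> under the binomial distribution with parameters \<open>k, x\<close>.\<close>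

definition avg :: "real \<Rightarrow> (nat \<Rightarrow> real) \<Rightarrow> nat \<Rightarrow> real" where
  "avg x f = (\<lambda>i. x * f (Suc i) + (1 - x) * f i)"

definition fdiff :: "(nat \<Rightarrow> real) \<Rightarrow> nat \<Rightarrow> real" where
  "fdiff f = (\<lambda>i. f (Suc i) - f i)"

lemma funpow_avg_Suc: "(avg x ^^ Suc k) f i = x * (avg x ^^ k) f (Suc i) + (1 - x) * (avg x ^^ k) f i"
  unfolding funpow.simps o_apply avg_def[of x "(avg x ^^ k) f"] ..

lemma avg_fdiff: "avg x (fdiff f) = fdiff (avg x f)"
  by (auto simp: avg_def fdiff_def algebra_simps)

lemma funpow_avg_fdiff: "(avg x ^^ a) (fdiff f) = fdiff ((avg x ^^ a) f)"
  by (induction a) (auto simp: avg_fdiff)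

lemma funpow_fdiff_avg: "(fdiff ^^ b) (avg x f) = avg x ((fdiff ^^ b) f)"
  by (induction b) (auto simp: avg_fdiff)

lemma funpow_avg_linear:
  "(avg x ^^ a) (\<lambda>i. \<alpha> * f i + \<beta> * g i) = (\<lambda>i. \<alpha> * (avg x ^^ a) f i + \<beta> * (avg x ^^ a) g i)"
  by (induction a) (auto simp: avg_def algebra_simps)

lemma funpow_fdiff_linear:
  "(fdiff ^^ b) (\<lambda>i. \<alpha> * f i + \<beta> * g i) = (\<lambda>i. \<alpha> * (fdiff ^^ b) f i + \<beta> * (fdiff ^^ b) g i)"
  by (induction b) (auto simp: fdiff_def algebra_simps)

text \<open>The expectation of the \<open>b\<close>-th forward difference of \<open>f\<close> under
  the binomial distribution with parameters \<open>a, x\<close>. By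
  \<open>funpow_avg_derivative\<close>, for \<open>b \<le> k\<close> and \<open>a = k - b\<close> it
  is the \<open>b\<close>-th derivative in \<open>x\<close> of \<open>(avg x ^^ k) f 0\<close>,
  divided by k (k - 1) ... (k - b + 1).\<close>

definition mixed :: "real \<Rightarrow> nat \<Rightarrow> nat \<Rightarrow> (nat \<Rightarrow> real) \<Rightarrow> real" where
  "mixed x a b f = (avg x ^^ a) ((fdiff ^^ b) f) 0"

lemma mixed_linear:
  "mixed x a b (\<lambda>i. \<alpha> * f i + \<beta> * g i) = \<alpha> * mixed x a b f + \<beta> * mixed x a b g"
  by (simp add: mixed_def funpow_avg_linear funpow_fdiff_linear)

text \<open>Since \<open>avg x\<close> and \<open>fdiff\<close> commute, one more operator applied
  to \<open>f\<close> only raises the corresponding counter.\<close>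

lemma mixed_avg: "mixed x a b (avg x f) = mixed x (Suc a) b f"
  by (simp add: mixed_def funpow_fdiff_avg funpow_swap1 del: funpow.simps) (simp add: funpow_swap1)

lemma mixed_fdiff: "mixed x a b (fdiff f) = mixed x a (Suc b) f"
  by (simp add: mixed_def funpow_swap1)

lemma mixed_avg_eq: "mixed x a b (avg x f) = x * mixed x a b (\<lambda>i. f (Suc i)) + (1 - x) * mixed x a b f"
  unfolding avg_def by (rule mixed_linear)

lemma mixed_fdiff_eq: "mixed x a b (fdiff f) = mixed x a b (\<lambda>i. f (Suc i)) - mixed x a b f"
  using mixed_linear[of x a b 1 "\<lambda>i. f (Suc i)" "-1" f] by (simp add: fdiff_def)

text \<open>Pascal's rule in summed form; the boundary terms fit because
  \<open>k choose Suc k\<close> is 0.\<close>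

lemma pascal_sum:
  fixes A :: "nat \<Rightarrow> real"
  shows "(\<Sum>j\<le>k. real (k choose j) * A j) + (\<Sum>j\<le>k. real (k choose j) * A (Suc j))
    = (\<Sum>j\<le>Suc k. real (Suc k choose j) * A j)"
proof -
  have "(\<Sum>j\<le>k. real (k choose j) * A j) = (\<Sum>j\<le>Suc k. real (k choose j) * A j)"
    by simp
  also have "\<dots> = A 0 + (\<Sum>j\<le>k. real (k choose Suc j) * A (Suc j))"
    by (subst sum.atMost_Suc_shift) simp
  finally have "(\<Sum>j\<le>k. real (k choose j) * A j) = A 0 + (\<Sum>j\<le>k. real (k choose Suc j) * A (Suc j))" .
  moreover have "(\<Sum>j\<le>Suc k. real (Suc k choose j) * A j)
      = A 0 + (\<Sum>j\<le>k. real (Suc k choose Suc j) * A (Suc j))"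
    by (subst sum.atMost_Suc_shift) simp
  ultimately show ?thesis
    by (simp add: sum.distrib distrib_right del: sum.atMost_Suc)
qed

text \<open>
  The expectation of \<open>f i * g j\<close> where \<open>i, j\<close> count the ones in \<open>k\<close> independent pairs of bits, each bit having mean
  \<open>x\<close> and the two bits of a pair having covariance \<open>z\<close>. One such pair acts as \<open>avg \<otimes> avg + z fdiff \<otimes> fdiff\<close>.
\<close>

definition pair_poly :: "nat \<Rightarrow> real \<Rightarrow> real \<Rightarrow> (nat \<Rightarrow> real) \<Rightarrow> (nat \<Rightarrow> real) \<Rightarrow> real" where
  "pair_poly k x z f g = (\<Sum>j\<le>k. real (k choose j) * (z ^ j * (mixed x (k - j) j f * mixed x (k - j) j g)))"

text \<open>\<open>pair_poly\<close> is the binomial expansion of the \<open>k\<close>-th power of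
  the one-pair operator, whose two summands commute. Splitting off one factor leaves two sums that
  Pascal's rule recombines.\<close>

lemma pair_poly_Suc:
  "pair_poly (Suc k) x z f g = pair_poly k x z (avg x f) (avg x g) + z * pair_poly k x z (fdiff f) (fdiff g)"
proof -
  have "pair_poly k x z (avg x f) (avg x g)
      = (\<Sum>j\<le>k. real (k choose j) * (z ^ j * (mixed x (Suc k - j) j f * mixed x (Suc k - j) j g)))"
    unfolding pair_poly_def by (intro sum.cong) (auto simp: mixed_avg Suc_diff_le)
  moreover have "z * pair_poly k x z (fdiff f) (fdiff g)
      = (\<Sum>j\<le>k. real (k choose j) * (z ^ Suc j * (mixed x (Suc k - Suc j) (Suc j) f * mixed x (Suc k - Suc j) (Suc j) g)))"
    unfolding pair_poly_def sum_distrib_left by (intro sum.cong) (auto simp: mixed_fdiff algebra_simps)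
  ultimately show ?thesis
    unfolding pair_poly_def[of "Suc k"]
    using pascal_sum[of k "\<lambda>j. z ^ j * (mixed x (Suc k - j) j f * mixed x (Suc k - j) j g)"]
    by simp
qed

section \<open>Sums over all constraints, for one and for two valuations\<close>

abbreviation hits :: "nat set \<Rightarrow> nat list \<Rightarrow> nat" where
  "hits S c \<equiv> length (filter (\<lambda>v. v \<in> S) c)"

lemma sat_constraint_hits: "sat_constraint I S c \<longleftrightarrow> hits S c \<in> I"
  by (simp add: sat_constraint_def length_filter_conv_card)

lemma constraints_0: "constraints 0 n = {[]}"
  by (auto simp: constraints_def)

lemma constraints_Suc: "constraints (Suc k) n = (\<lambda>(v, c). v # c) ` ({..<n} \<times> constraints k n)"
proof (intro equalityI subsetI)
  fix c assume "c \<in> constraints (Suc k) n"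
  then show "c \<in> (\<lambda>(v, c). v # c) ` ({..<n} \<times> constraints k n)"
    by (cases c) (auto simp: constraints_def)
qed (auto simp: constraints_def)

lemma sum_constraints_Suc:
  fixes F :: "nat list \<Rightarrow> real"
  shows "(\<Sum>c\<in>constraints (Suc k) n. F c) = (\<Sum>v<n. \<Sum>c\<in>constraints k n. F (v # c))"
  unfolding constraints_Suc
  by (subst sum.reindex) (auto simp: inj_on_def sum.cartesian_product case_prod_unfold)

lemma finite_constraints: "finite (constraints k n)"
  and card_constraints: "card (constraints k n) = n ^ k"
proof -
  have eq: "constraints k n = {c. set c \<subseteq> {..<n} \<and> length c = k}"
    by (auto simp: constraints_def)
  show "finite (constraints k n)" unfolding eq by (rule finite_lists_length_eq) simp
  show "card (constraints k n) = n ^ k" unfolding eq by (subst card_lists_length_eq) auto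
qed

text \<open>A function of two bits is a combination of the indicators of
  \<open>S \<inter> T\<close>, \<open>S\<close>, \<open>T\<close> and a constant, so only
  cardinalities enter. The coefficients are the sizes of the four cells into which \<open>S\<close>
  and \<open>T\<close> cut the variables.\<close>

lemma sum_over_two_sets:
  fixes Ff :: "bool \<Rightarrow> bool \<Rightarrow> real"
  assumes "S \<subseteq> {..<n}" "T \<subseteq> {..<n}"
  shows "(\<Sum>v<n. Ff (v \<in> S) (v \<in> T))
    = real (card (S \<inter> T)) * Ff True True + (real (card S) - real (card (S \<inter> T))) * Ff True False
    + (real (card T) - real (card (S \<inter> T))) * Ff False True
    + (real n - real (card S) - real (card T) + real (card (S \<inter> T))) * Ff False False"
proof -
  have ind: "(\<Sum>v<n. of_bool (v \<in> A)) = real (card A)" if "A \<subseteq> {..<n}" for A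
  proof -
    have "{..<n} \<inter> A = A" using that by auto
    then show ?thesis by (simp add: of_bool_def sum.If_cases)
  qed
  have *: "Ff (v \<in> S) (v \<in> T) = of_bool (v \<in> S \<inter> T) * (Ff True True - Ff True False - Ff False True + Ff False False)
     + of_bool (v \<in> S) * (Ff True False - Ff False False) + of_bool (v \<in> T) * (Ff False True - Ff False False)
     + Ff False False" for v
    by (cases "v \<in> S"; cases "v \<in> T") auto
  have "S \<inter> T \<subseteq> {..<n}" using assms by auto
  then show ?thesis
    unfolding * sum.distrib sum_distrib_right[symmetric]
    by (simp only: ind assms) (simp add: algebra_simps)
qed

text \<open>For a uniform variable \<open>v\<close> the bits \<open>v \<in> S\<close> and
  \<open>v \<in> T\<close> have mean \<open>x\<close> and covariance \<open>z\<close>, and the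
  coordinates of a constraint are independent. The induction peels off one coordinate, which may
  raise the arguments of \<open>f\<close> and \<open>g\<close> by one; hence both are
  generalized.\<close>

lemma sum_constraints_pair:
  assumes "S \<subseteq> {..<n}" "T \<subseteq> {..<n}" "card S = s" "card T = s" "n > 0"
  defines "x \<equiv> real s / real n" and "z \<equiv> real (card (S \<inter> T)) / real n - (real s / real n)\<^sup>2"
  shows "(\<Sum>c\<in>constraints k n. f (hits S c) * g (hits T c)) = real n ^ k * pair_poly k x z f g"
proof (induction k arbitrary: f g)
  case 0
  show ?case by (simp add: constraints_0 pair_poly_def mixed_def)
next
  case (Suc k)
  define sh where "sh b (f :: nat \<Rightarrow> real) = (if b then (\<lambda>i. f (Suc i)) else f)" for b f
  have sh: "f (hits S (v # c)) = sh (v \<in> S) f (hits S c)" for v c S and f :: "nat \<Rightarrow> real"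
    by (simp add: sh_def)
  let ?P = "pair_poly k x z"
  let ?t = "real (card (S \<inter> T))"
  let ?F = "\<lambda>a b. ?P (sh a f) (sh b g)"
  have "(\<Sum>c\<in>constraints (Suc k) n. f (hits S c) * g (hits T c))
      = (\<Sum>v<n. real n ^ k * ?P (sh (v \<in> S) f) (sh (v \<in> T) g))"
    unfolding sum_constraints_Suc sh Suc.IH ..
  also have "\<dots> = real n ^ k * (?t * ?F True True + (real s - ?t) * ?F True False
      + (real s - ?t) * ?F False True + (real n - 2 * real s + ?t) * ?F False False)"
    unfolding sum_distrib_left[symmetric]
    by (subst sum_over_two_sets[of S n T ?F]) (use assms in auto)
  \<comment> \<open>Dividing the cell sizes by \<open>n\<close> gives the joint distribution of the
    two bits in terms of mean and covariance.\<close>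
  also have "?t * ?F True True + (real s - ?t) * ?F True False
      + (real s - ?t) * ?F False True + (real n - 2 * real s + ?t) * ?F False False
      = real n * ((x\<^sup>2 + z) * ?F True True + (x * (1 - x) - z) * ?F True False
      + (x * (1 - x) - z) * ?F False True + ((1 - x)\<^sup>2 + z) * ?F False False)"
  proof -
    have a: "real n * (x\<^sup>2 + z) = ?t" using \<open>n > 0\<close> by (simp add: x_def z_def)
    have b: "real n * x = real s" using \<open>n > 0\<close> by (simp add: x_def)
    have c: "real n * (x * (1 - x) - z) = real s - ?t"
      using a b by (simp add: algebra_simps power2_eq_square)
    have d: "real n * ((1 - x)\<^sup>2 + z) = real n - 2 * real s + ?t"
      using a b by (simp add: algebra_simps power2_eq_square)
    have "real n * (a * p + b * q + b * q' + d * q'') = (real n * a) * p + (real n * b) * q + (real n * b) * q' + (real n * d) * q''"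
      for a b d p q q' q'' :: real by (simp add: algebra_simps)
    then show ?thesis by (simp only: a c d)
  qed
  \<comment> \<open>The joint distribution is the product distribution plus \<open>z\<close> times
    the signs +1, -1, -1, +1; the product part acts as \<open>avg x\<close> on both functions, the
    signs as \<open>fdiff\<close> on both.\<close>
  also have "(x\<^sup>2 + z) * ?F True True + (x * (1 - x) - z) * ?F True False
      + (x * (1 - x) - z) * ?F False True + ((1 - x)\<^sup>2 + z) * ?F False False
      = ?P (avg x f) (avg x g) + z * ?P (fdiff f) (fdiff g)"
    unfolding pair_poly_def mixed_avg_eq mixed_fdiff_eq sh_def sum_distrib_left sum.distrib[symmetric]
    by (intro sum.cong) (auto simp: algebra_simps power2_eq_square)
  finally show ?case by (simp add: pair_poly_Suc)
qed

text \<open>The same induction for one valuation: \<open>hits S c\<close> is binomially distributed.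
  Taking \<open>T = S\<close> in \<open>sum_over_two_sets\<close> makes the two mixed cells
  empty.\<close>

lemma sum_constraints_single:
  assumes "S \<subseteq> {..<n}" "n > 0"
  shows "(\<Sum>c\<in>constraints k n. f (hits S c)) = real n ^ k * (avg (real (card S) / real n) ^^ k) f 0"
proof (induction k arbitrary: f)
  case 0
  show ?case by (simp add: constraints_0)
next
  case (Suc k)
  let ?x = "real (card S) / real n"
  define sh where "sh b (f :: nat \<Rightarrow> real) = (if b then (\<lambda>i. f (Suc i)) else f)" for b f
  have sh: "f (hits S (v # c)) = sh (v \<in> S) f (hits S c)" for v c S and f :: "nat \<Rightarrow> real"
    by (simp add: sh_def)
  let ?F = "\<lambda>a. (avg ?x ^^ k) (sh a f) 0"
  have "(\<Sum>c\<in>constraints (Suc k) n. f (hits S c)) = (\<Sum>v<n. real n ^ k * ?F (v \<in> S))"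
    unfolding sum_constraints_Suc sh Suc.IH ..
  also have "\<dots> = real n ^ k * (real (card S) * ?F True + (real n - real (card S)) * ?F False)"
    unfolding sum_distrib_left[symmetric]
    by (subst sum_over_two_sets[of S n S "\<lambda>a b. ?F a"]) (use assms in auto)
  also have "\<dots> = real n ^ Suc k * (?x * ?F True + (1 - ?x) * ?F False)"
    using \<open>n > 0\<close> by (simp add: field_simps)
  also have "?x * ?F True + (1 - ?x) * ?F False = (avg ?x ^^ k) (avg ?x f) 0"
    unfolding sh_def avg_def[of _ f] funpow_avg_linear by simp
  finally show ?case by (simp add: funpow_swap1)
qed

text \<open>The derivative of \<open>avg x\<close> in \<open>x\<close> is \<open>fdiff\<close>. As
  the two commute, the product rule gives \<open>k\<close> equal terms.\<close>

lemma funpow_avg_derivative: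
  "((\<lambda>x. (avg x ^^ k) f a) has_real_derivative real k * (avg x ^^ (k - 1)) (fdiff f) a) (at x)"
proof (induction k arbitrary: a)
  case 0
  show ?case by simp
next
  case (Suc k)
  \<comment> \<open>For \<open>k = 0\<close> the truncated exponent \<open>k - 1\<close> is harmless
    because of the factor \<open>real k\<close>.\<close>
  have "real k * ((avg x ^^ k) (fdiff f) a)
      = real k * (x * (avg x ^^ (k - 1)) (fdiff f) (Suc a) + (1 - x) * (avg x ^^ (k - 1)) (fdiff f) a)"
    by (cases k) (auto simp: avg_def)
  then have *: "real (Suc k) * (avg x ^^ k) (fdiff f) a =
     (avg x ^^ k) f (Suc a) - (avg x ^^ k) f a
     + (x * (real k * (avg x ^^ (k - 1)) (fdiff f) (Suc a)) + (1 - x) * (real k * (avg x ^^ (k - 1)) (fdiff f) a))"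
    unfolding funpow_avg_fdiff by (simp add: fdiff_def algebra_simps)
  have "((\<lambda>x. x * (avg x ^^ k) f (Suc a) + (1 - x) * (avg x ^^ k) f a) has_real_derivative
     real (Suc k) * (avg x ^^ k) (fdiff f) a) (at x)"
    unfolding * by (rule derivative_eq_intros Suc.IH refl | simp)+
  then show ?case by (simp only: funpow_avg_Suc diff_Suc_1)
qed

lemma funpow_avg_continuous: "continuous_on A (\<lambda>x. (avg x ^^ k) f a)"
  by (rule continuous_at_imp_continuous_on) (use funpow_avg_derivative DERIV_isCont in blast)

lemma funpow_avg_nonneg:
  assumes "\<And>i. f i \<ge> 0" "0 \<le> x" "x \<le> 1"
  shows "(avg x ^^ k) f a \<ge> 0"
  by (induction k arbitrary: a) (use assms in \<open>auto simp: avg_def\<close>)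

text \<open>For \<open>x\<close> strictly between 0 and 1 every value \<open>i \<le> k\<close> has
  positive binomial probability.\<close>

lemma funpow_avg_pos:
  assumes "\<And>i. f i \<ge> 0" "0 < x" "x < 1" "i \<le> k" "f (a + i) > 0"
  shows "(avg x ^^ k) f a > 0"
  using assms(4,5)
proof (induction k arbitrary: a i)
  case 0
  then show ?case by simp
next
  case (Suc k)
  have nn: "(avg x ^^ k) f b \<ge> 0" for b
    using funpow_avg_nonneg assms(1-3) by (meson less_imp_le)
  show ?case
  proof (cases "i \<le> k")
    case True
    then have "(avg x ^^ k) f a > 0" using Suc by blast
    then have "(1 - x) * (avg x ^^ k) f a > 0" using assms by simp
    then show ?thesis using nn[of "Suc a"] assms(2) by (simp add: funpow_avg_Suc del: funpow.simps add: add_nonneg_pos)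
  next
    case False
    then have "(avg x ^^ k) f (Suc a) > 0" using Suc.prems by (intro Suc.IH[of k]) (auto simp: le_Suc_eq)
    then show ?thesis using nn[of a] assms(2,3) by (simp add: funpow_avg_Suc add_pos_nonneg del: funpow.simps)
  qed
qed

lemma funpow_avg_0: "(avg 0 ^^ k) f = f"
  by (induction k) (auto simp: avg_def)

lemma funpow_avg_1: "(avg 1 ^^ k) f = (\<lambda>i. f (i + k))"
  by (induction k) (auto simp: avg_def)

text \<open>The polynomial takes the values \<open>f 0 = 0\<close> and \<open>f k = 0\<close> at the
  endpoints and is positive at 1/2, so its maximum on the unit interval is interior and its
  derivative vanishes there.\<close>

lemma exists_critical_point:
  assumes "\<And>i. f i \<ge> 0" "f 0 = 0" "f k = 0" "i \<le> k" "f i > 0"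
  shows "\<exists>\<delta>. 0 < \<delta> \<and> \<delta> < 1 \<and> (avg \<delta> ^^ (k - 1)) (fdiff f) 0 = 0"
proof -
  let ?p = "\<lambda>x. (avg x ^^ k) f 0"
  obtain \<delta> where \<delta>: "\<delta> \<in> {0..1}" "\<And>x. x \<in> {0..1} \<Longrightarrow> ?p x \<le> ?p \<delta>"
    using continuous_attains_sup[of "{0..1::real}" ?p] funpow_avg_continuous by fastforce
  have "?p (1/2) > 0" using funpow_avg_pos[of f "1/2" i k 0] assms by simp
  then have "?p \<delta> > 0" using \<delta>(2)[of "1/2"] by simp
  then have "\<delta> \<noteq> 0" "\<delta> \<noteq> 1"
    using assms by (auto simp: funpow_avg_0 funpow_avg_1)
  then have d: "0 < \<delta>" "\<delta> < 1" using \<delta>(1) by auto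
  have "real k * (avg \<delta> ^^ (k - 1)) (fdiff f) 0 = 0"
  proof (rule DERIV_local_max[OF funpow_avg_derivative])
    show "0 < min \<delta> (1 - \<delta>)" using d by simp
    show "\<forall>y. \<bar>\<delta> - y\<bar> < min \<delta> (1 - \<delta>) \<longrightarrow> ?p y \<le> ?p \<delta>"
      using \<delta>(2) by (auto simp: abs_if split: if_splits)
  qed
  moreover have "k \<noteq> 0" using assms by (cases k) auto
  ultimately show ?thesis using d by auto
qed

section \<open>The moments\<close>

text \<open>Independence of the \<open>m\<close> draws: an instance all of whose constraints satisfy
  \<open>P\<close> is a list over the constraints satisfying \<open>P\<close>.\<close>

lemma card_instances_all:
  "card {F \<in> instances k m n. \<forall>c\<in>set F. P c} = card {c \<in> constraints k n. P c} ^ m"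
proof -
  have "{F \<in> instances k m n. \<forall>c\<in>set F. P c} = {F. set F \<subseteq> {c \<in> constraints k n. P c} \<and> length F = m}"
    by (auto simp: instances_def)
  then show ?thesis by (simp add: card_lists_length_eq finite_constraints)
qed

lemma finite_instances: "finite (instances k m n)"
proof -
  have "instances k m n = {F. set F \<subseteq> constraints k n \<and> length F = m}"
    by (auto simp: instances_def)
  then show ?thesis by (simp add: finite_lists_length_eq finite_constraints)
qed

lemma card_instances: "card (instances k m n) = (n ^ k) ^ m"
  using card_instances_all[of k m n "\<lambda>_. True"] by (simp add: card_constraints)

lemma expectation_random_instance:
  assumes "n > 0"
  shows "measure_pmf.expectation (random_instance k m n) (g :: _ \<Rightarrow> real)
    = (\<Sum>F\<in>instances k m n. g F) / (real n ^ k) ^ m"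
proof -
  have "card (instances k m n) > 0" using assms by (simp add: card_instances)
  then have "instances k m n \<noteq> {}" by auto
  then show ?thesis
    unfolding random_instance_def
    by (simp add: integral_pmf_of_set finite_instances card_instances)
qed

lemma finite_delta_valuations: "finite (delta_valuations \<delta> n)"
  by (rule finite_subset[of _ "Pow {..<n}"]) (auto simp: delta_valuations_def)

lemma num_delta_solutions_sum:
  "real (num_delta_solutions I \<delta> n F) = (\<Sum>S\<in>delta_valuations \<delta> n. of_bool (sat_instance I S F))"
  unfolding num_delta_solutions_def
  by (simp add: of_bool_def sum.If_cases finite_delta_valuations Int_def conj_commute)

definition member_ind :: "nat set \<Rightarrow> nat \<Rightarrow> real" where
  "member_ind I i = of_bool (i \<in> I)"

lemma sum_instances_all:
  "(\<Sum>F\<in>instances k m n. of_bool (\<forall>c\<in>set F. P c)) = (\<Sum>c\<in>constraints k n. of_bool (P c) :: real) ^ m"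
proof -
  have "(\<Sum>F\<in>instances k m n. of_bool (\<forall>c\<in>set F. P c)) = real (card {F \<in> instances k m n. \<forall>c\<in>set F. P c})"
    by (simp add: of_bool_def sum.If_cases finite_instances Int_def conj_commute)
  moreover have "(\<Sum>c\<in>constraints k n. of_bool (P c)) = real (card {c \<in> constraints k n. P c})"
    by (simp add: of_bool_def sum.If_cases finite_constraints Int_def conj_commute)
  ultimately show ?thesis by (simp add: card_instances_all)
qed

lemma sum_instances_single:
  assumes "S \<subseteq> {..<n}" "n > 0"
  shows "(\<Sum>F\<in>instances k m n. of_bool (sat_instance I S F))
    = (real n ^ k) ^ m * ((avg (real (card S) / real n) ^^ k) (member_ind I) 0) ^ m"
  unfolding sat_instance_def sum_instances_all sat_constraint_hits
  using sum_constraints_single[OF assms, of "member_ind I" k]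
  by (simp add: member_ind_def power_mult_distrib)

lemma sum_instances_pair:
  assumes "S \<subseteq> {..<n}" "T \<subseteq> {..<n}" "card S = s" "card T = s" "n > 0"
  shows "(\<Sum>F\<in>instances k m n. of_bool (sat_instance I S F) * of_bool (sat_instance I T F))
    = (real n ^ k) ^ m * (pair_poly k (real s / real n) (real (card (S \<inter> T)) / real n - (real s / real n)\<^sup>2)
        (member_ind I) (member_ind I)) ^ m"
proof -
  have "of_bool (sat_instance I S F) * of_bool (sat_instance I T F)
     = (of_bool (\<forall>c\<in>set F. hits S c \<in> I \<and> hits T c \<in> I) :: real)" for F
    by (auto simp: sat_instance_def sat_constraint_hits)
  then have "(\<Sum>F\<in>instances k m n. of_bool (sat_instance I S F) * of_bool (sat_instance I T F))
     = (\<Sum>c\<in>constraints k n. of_bool (hits S c \<in> I \<and> hits T c \<in> I) :: real) ^ m"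
    by (simp only: sum_instances_all)
  then show ?thesis
    using sum_constraints_pair[OF assms, where k = k and f = "member_ind I" and g = "member_ind I"]
    by (simp add: member_ind_def power_mult_distrib flip: of_bool_conj)
qed

text \<open>\<open>T\<close> is determined by the independent choices of \<open>S \<inter> T\<close>
  inside \<open>S\<close> and \<open>T - S\<close> outside.\<close>

lemma card_sets_with_overlap:
  assumes "S \<subseteq> {..<n}" "card S = s" "t \<le> s"
  shows "card {T. T \<subseteq> {..<n} \<and> card T = s \<and> card (S \<inter> T) = t} = (s choose t) * ((n - s) choose (s - t))"
proof -
  let ?A = "{A. A \<subseteq> S \<and> card A = t}" and ?B = "{B. B \<subseteq> {..<n} - S \<and> card B = s - t}"
  have fin: "finite S" using assms(1) finite_subset by blast
  have "bij_betw (\<lambda>(A, B). A \<union> B) (?A \<times> ?B) {T. T \<subseteq> {..<n} \<and> card T = s \<and> card (S \<inter> T) = t}"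
  proof (rule bij_betw_byWitness[where f' = "\<lambda>T. (S \<inter> T, T - S)"])
    show "\<forall>p\<in>?A \<times> ?B. (\<lambda>T. (S \<inter> T, T - S)) ((\<lambda>(A, B). A \<union> B) p) = p"
      by auto
    show "\<forall>T\<in>{T. T \<subseteq> {..<n} \<and> card T = s \<and> card (S \<inter> T) = t}. (\<lambda>(A, B). A \<union> B) (S \<inter> T, T - S) = T"
      by auto
    show "(\<lambda>(A, B). A \<union> B) ` (?A \<times> ?B) \<subseteq> {T. T \<subseteq> {..<n} \<and> card T = s \<and> card (S \<inter> T) = t}"
    proof clarsimp
      fix A B assume h: "A \<subseteq> S" "B \<subseteq> {..<n} - S" "card B = s - card A" "t = card A"
      have f: "finite A" "finite B" using h fin finite_subset by (blast, metis finite_Diff finite_lessThan finite_subset)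
      have "A \<inter> B = {}" using h by auto
      then have "card (A \<union> B) = s" using f h assms by (simp add: card_Un_disjoint)
      moreover have "S \<inter> (A \<union> B) = A" using h by auto
      moreover have "A \<subseteq> {..<n}" "B \<subseteq> {..<n}" using h assms by auto
      ultimately show "A \<subseteq> {..<n} \<and> B \<subseteq> {..<n} \<and> card (A \<union> B) = s \<and> card (S \<inter> (A \<union> B)) = card A"
        by simp
    qed
    show "(\<lambda>T. (S \<inter> T, T - S)) ` {T. T \<subseteq> {..<n} \<and> card T = s \<and> card (S \<inter> T) = t} \<subseteq> ?A \<times> ?B"
      using fin by (auto simp: card_Diff_subset_Int Int_commute)
  qed
  then have "card {T. T \<subseteq> {..<n} \<and> card T = s \<and> card (S \<inter> T) = t} = card (?A \<times> ?B)"
    by (simp add: bij_betw_same_card)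
  also have "\<dots> = (s choose t) * ((n - s) choose (s - t))"
    using assms fin by (simp add: card_cartesian_product n_subsets card_Diff_subset)
  finally show ?thesis .
qed

text \<open>The unnormalised hypergeometric weight. The overlap is an integer so that it can be
  written as the mode plus a shift of either sign; beyond \<open>s\<close> the truncated difference
  does no harm, as \<open>s choose nat t\<close> is 0.\<close>

definition overlap_weight :: "nat \<Rightarrow> nat \<Rightarrow> int \<Rightarrow> real" where
  "overlap_weight n s t = (if t < 0 then 0 else real (s choose nat t) * real ((n - s) choose (s - nat t)))"

lemma sum_by_overlap:
  fixes \<phi> :: "int \<Rightarrow> real"
  assumes "S \<subseteq> {..<n}" "card S = s"
  shows "(\<Sum>T | T \<subseteq> {..<n} \<and> card T = s. \<phi> (int (card (S \<inter> T)))) = (\<Sum>t\<in>{0..int s}. overlap_weight n s t * \<phi> t)"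
proof -
  let ?V = "{T. T \<subseteq> {..<n} \<and> card T = s}"
  have fin: "finite S" using assms(1) finite_subset by blast
  have "(\<Sum>T\<in>?V. \<phi> (int (card (S \<inter> T)))) = (\<Sum>t\<le>s. \<Sum>T | T \<in> ?V \<and> card (S \<inter> T) = t. \<phi> (int (card (S \<inter> T))))"
    by (rule sum.group[symmetric]) (use fin assms in \<open>auto intro: finite_subset[of _ "Pow {..<n}"] card_mono\<close>)
  also have "\<dots> = (\<Sum>t\<le>s. overlap_weight n s (int t) * \<phi> (int t))"
    using card_sets_with_overlap[OF assms] by (intro sum.cong) (auto simp: overlap_weight_def conj_assoc)
  also have "\<dots> = (\<Sum>t\<in>{0..int s}. overlap_weight n s t * \<phi> t)"
    by (rule sum.reindex_bij_witness[of _ nat int]) auto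
  finally show ?thesis .
qed

text \<open>By linearity both moments are sums over valuations. With C the number of valuations, the
  first moment is \<open>p ^ m\<close> times C. In the second, the inner sum over \<open>T\<close>
  depends on \<open>S\<close> only through the overlap, hence not on \<open>S\<close> at all, and
  gives another factor C. After cancelling, C itself remains as the numerator.\<close>

lemma moment_ratio:
  fixes \<delta> :: real and I :: "nat set" and k m n :: nat
  assumes "n > 0" "0 \<le> \<delta>" "\<delta> \<le> 1"
  defines "s \<equiv> nat \<lfloor>\<delta> * real n\<rfloor>"
  defines "x \<equiv> real s / real n"
  defines "p \<equiv> (avg x ^^ k) (member_ind I) 0"
  assumes "p > 0"
  shows "(measure_pmf.expectation (random_instance k m n) (\<lambda>F. real (num_delta_solutions I \<delta> n F)))\<^sup>2
      / measure_pmf.expectation (random_instance k m n) (\<lambda>F. (real (num_delta_solutions I \<delta> n F))\<^sup>2)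
    = (\<Sum>t\<in>{0..int s}. overlap_weight n s t) / (\<Sum>t\<in>{0..int s}. overlap_weight n s t *
        (pair_poly k x (of_int t / real n - x\<^sup>2) (member_ind I) (member_ind I) / p\<^sup>2) ^ m)"
proof -
  let ?V = "delta_valuations \<delta> n"
  let ?N = "(real n ^ k) ^ m"
  let ?Q = "\<lambda>t::int. pair_poly k x (of_int t / real n - x\<^sup>2) (member_ind I) (member_ind I)"
  have V: "?V = {T. T \<subseteq> {..<n} \<and> card T = s}" by (simp add: delta_valuations_def s_def)
  have N: "?N > 0" using assms by simp
  have "\<delta> * real n \<le> 1 * real n" using assms by (intro mult_right_mono) auto
  then have sn: "s \<le> n" unfolding s_def by linarith
  let ?C = "\<Sum>t\<in>{0..int s}. overlap_weight n s t"
  have cardV: "real (card ?V) = real (n choose s)"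
    unfolding V by (subst n_subsets) auto
  \<comment> \<open>Counting all valuations by their overlap with the sample valuation
    \<open>{..<s}\<close> is Vandermonde's identity.\<close>
  have "card {..<s} = s" "{..<s} \<subseteq> {..<n}" using sn by auto
  from sum_by_overlap[OF this(2,1), of "\<lambda>_. 1"] have C: "real (card ?V) = ?C"
    unfolding V by simp
  have Cpos: "?C > 0" using cardV C sn by simp
  have "(\<Sum>F\<in>instances k m n. real (num_delta_solutions I \<delta> n F))
      = (\<Sum>S\<in>?V. \<Sum>F\<in>instances k m n. of_bool (sat_instance I S F))"
    unfolding num_delta_solutions_sum by (rule sum.swap)
  also have "\<dots> = (\<Sum>S\<in>?V. ?N * p ^ m)"
    by (intro sum.cong refl) (use assms(1) in \<open>auto simp: sum_instances_single V p_def x_def\<close>)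
  finally have E1: "measure_pmf.expectation (random_instance k m n) (\<lambda>F. real (num_delta_solutions I \<delta> n F)) = ?C * p ^ m"
    using N C \<open>n > 0\<close> by (simp add: expectation_random_instance[OF assms(1)])
  have "(\<Sum>F\<in>instances k m n. (real (num_delta_solutions I \<delta> n F))\<^sup>2)
      = (\<Sum>F\<in>instances k m n. \<Sum>S\<in>?V. \<Sum>T\<in>?V. of_bool (sat_instance I S F) * of_bool (sat_instance I T F))"
    unfolding num_delta_solutions_sum power2_eq_square sum_product ..
  also have "\<dots> = (\<Sum>S\<in>?V. \<Sum>T\<in>?V. \<Sum>F\<in>instances k m n. of_bool (sat_instance I S F) * of_bool (sat_instance I T F))"
    by (subst sum.swap, rule sum.cong[OF refl], rule sum.swap)
  also have "\<dots> = (\<Sum>S\<in>?V. \<Sum>T\<in>?V. ?N * ?Q (int (card (S \<inter> T))) ^ m)"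
    by (intro sum.cong refl, subst sum_instances_pair[where s = s]) (use assms(1) in \<open>auto simp: V x_def\<close>)
  also have "\<dots> = (\<Sum>S\<in>?V. ?N * (\<Sum>t\<in>{0..int s}. overlap_weight n s t * ?Q t ^ m))"
    unfolding sum_distrib_left[symmetric]
    by (intro arg_cong[where f = "(*) _"] sum.cong refl, unfold V, rule sum_by_overlap) auto
  finally have E2: "measure_pmf.expectation (random_instance k m n) (\<lambda>F. (real (num_delta_solutions I \<delta> n F))\<^sup>2)
      = ?C * (\<Sum>t\<in>{0..int s}. overlap_weight n s t * ?Q t ^ m)"
    using N C \<open>n > 0\<close> by (simp add: expectation_random_instance[OF assms(1)])
  have "(\<Sum>t\<in>{0..int s}. overlap_weight n s t * (?Q t / p\<^sup>2) ^ m)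
      = (\<Sum>t\<in>{0..int s}. overlap_weight n s t * ?Q t ^ m) / (p ^ m)\<^sup>2"
    unfolding sum_divide_distrib by (intro sum.cong refl) (simp add: power_divide power_mult[symmetric] mult.commute)
  then show ?thesis
    unfolding E1 E2 using Cpos \<open>p > 0\<close> by (simp add: power_mult_distrib power2_eq_square)
qed

section \<open>Riemann sums of Gaussian type\<close>

text \<open>Turns a sum over integers into a Lebesgue integral: the integrand is constant on
  intervals of length \<open>1 / c\<close>.\<close>

lemma step_function_integral:
  fixes a :: "int \<Rightarrow> real"
  assumes "c > 0" "finite J" "\<And>j. j \<notin> J \<Longrightarrow> a j = 0"
  shows "integral\<^sup>L lborel (\<lambda>u. a \<lfloor>c * u\<rfloor>) = (\<Sum>j\<in>J. a j) / c"
proof -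
  have eq: "a \<lfloor>c * u\<rfloor> = (\<Sum>j\<in>J. a j * indicator {of_int j / c..<(of_int j + 1) / c} u)" for u
  proof -
    have "a j * indicator {of_int j / c..<(of_int j + 1) / c} u = (if j = \<lfloor>c * u\<rfloor> then a j else 0)" for j
      using assms(1) by (auto simp: indicator_def field_simps floor_eq_iff eq_commute[of j])
    then have "(\<Sum>j\<in>J. a j * indicator {of_int j / c..<(of_int j + 1) / c} u)
        = (\<Sum>j\<in>J. if j = \<lfloor>c * u\<rfloor> then a j else 0)"
      by (intro sum.cong refl)
    then show ?thesis using assms(2,3) by simp
  qed
  have "of_int j / c \<le> (of_int j + 1) / c" for j
    using assms(1) by (simp add: field_simps)
  then show ?thesis
    unfolding eq using assms(1)
    by (subst Bochner_Integration.integral_sum)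
      (auto simp: sum_divide_distrib diff_divide_distrib[symmetric] intro!: sum.cong)
qed

lemma integrable_gaussian:
  assumes "c > (0::real)"
  shows "integrable lborel (\<lambda>u::real. exp (- c * u\<^sup>2))"
proof -
  define \<sigma> where "\<sigma> = 1 / sqrt (2 * c)"
  have "\<sigma> > 0" using assms by (simp add: \<sigma>_def)
  then have "integrable lborel (\<lambda>u. sqrt (2 * pi * \<sigma>\<^sup>2) * normal_density 0 \<sigma> u)"
    by (intro integrable_mult_right integrable_normal_density)
  moreover have "sqrt (2 * pi * \<sigma>\<^sup>2) * normal_density 0 \<sigma> u = exp (- c * u\<^sup>2)" for u
    using \<open>\<sigma> > 0\<close> assms by (simp add: normal_density_def \<sigma>_def power_divide)
  ultimately show ?thesis by simp
qed

text \<open>If the integral were 0, \<open>G\<close> would vanish almost everywhere, although it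
  vanishes nowhere and Lebesgue measure is not null.\<close>

lemma lborel_integral_pos:
  fixes G :: "real \<Rightarrow> real"
  assumes "integrable lborel G" "\<And>u. G u > 0"
  shows "integral\<^sup>L lborel G > 0"
proof -
  have "integral\<^sup>L lborel G \<noteq> 0"
  proof
    assume "integral\<^sup>L lborel G = 0"
    then have "AE u in lborel. G u = 0"
      using integral_nonneg_eq_0_iff_AE[OF assms(1)] assms(2) by (auto simp: less_imp_le)
    then have "AE u :: real in lborel. False"
      by (rule eventually_mono) (use assms(2) less_irrefl in metis)
    then show False by (simp add: eventually_False ae_filter_eq_bot_iff)
  qed
  moreover have "integral\<^sup>L lborel G \<ge> 0" using assms(2) by (simp add: less_imp_le)
  ultimately show ?thesis by simp
qed

text \<open>Rescaling by \<open>sqrt n\<close> makes the sum the integral of a step function with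
  pointwise limit \<open>G\<close>; the Gaussian bound yields an integrable majorant independent of
  \<open>n\<close>.\<close>

lemma scaled_sum_tendsto_integral:
  fixes a :: "nat \<Rightarrow> int \<Rightarrow> real" and G :: "real \<Rightarrow> real"
  assumes "c > 0" "\<And>n. finite (J n)"
    and supp: "\<And>n j. n \<ge> N \<Longrightarrow> j \<notin> J n \<Longrightarrow> a n j = 0"
    and bound: "\<And>n j. n \<ge> N \<Longrightarrow> \<bar>a n j\<bar> \<le> C * exp (- c * (of_int j)\<^sup>2 / real n)"
    and lim: "\<And>u. (\<lambda>n. a n \<lfloor>sqrt (real n) * u\<rfloor>) \<longlonglongrightarrow> G u"
    and [measurable]: "G \<in> borel_measurable borel"
  shows "integrable lborel G"
    and "(\<lambda>n. (\<Sum>j\<in>J n. a n j) / sqrt (real n)) \<longlonglongrightarrow> integral\<^sup>L lborel G"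
proof -
  \<comment> \<open>Beyond \<open>Suc N\<close> the index is also at least 1, so division by it is
    safe.\<close>
  define M where "M = Suc N"
  define s where "s i u = a (i + M) \<lfloor>sqrt (real (i + M)) * u\<rfloor>" for i u
  \<comment> \<open>For \<open>j = \<lfloor>sqrt n * u\<rfloor>\<close> one has
    \<open>j\<^sup>2 / n \<ge> u\<^sup>2 / 2 - 1\<close>. Rounding thus costs half of the exponent
    and a factor \<open>exp c\<close>.\<close>
  define w where "w u = C * exp c * exp (- (c / 2) * u\<^sup>2)" for u :: real
  have "\<bar>a N 0\<bar> \<le> C" using bound[of N 0] by simp
  then have C: "C \<ge> 0" by linarith
  have meas: "s i \<in> borel_measurable lborel" for i
  proof -
    have "(\<lambda>u. a (i + M) \<lfloor>sqrt (real (i + M)) * u\<rfloor>) \<in> borel_measurable borel"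
      by measurable
    then show ?thesis unfolding s_def by simp
  qed
  have w: "integrable lborel w" unfolding w_def
    by (intro integrable_mult_right integrable_gaussian) (use assms(1) in simp)
  have conv: "(\<lambda>i. s i u) \<longlonglongrightarrow> G u" for u
    unfolding s_def using lim[of u] by (rule LIMSEQ_ignore_initial_segment)
  have dom: "norm (s i u) \<le> w u" for i u
  proof -
    define n where "n = i + M"
    define j where "j = \<lfloor>sqrt (real n) * u\<rfloor>"
    have n: "n \<ge> N" "n \<ge> 1" by (auto simp: n_def M_def)
    have "\<bar>sqrt (real n) * u\<bar> \<le> \<bar>real_of_int j\<bar> + 1" unfolding j_def by linarith
    then have "(sqrt (real n) * u)\<^sup>2 \<le> (\<bar>real_of_int j\<bar> + 1)\<^sup>2"
      by (metis abs_ge_zero power2_abs power_mono)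
    also have "\<dots> \<le> 2 * (of_int j)\<^sup>2 + 2"
      using sum_squares_bound[of "\<bar>real_of_int j\<bar>" 1] by (simp add: power2_sum)
    finally have "real n * u\<^sup>2 / 2 - 1 \<le> (of_int j)\<^sup>2" by (simp add: power_mult_distrib)
    then have "(real n * u\<^sup>2 / 2 - 1) / real n \<le> (of_int j)\<^sup>2 / real n"
      by (rule divide_right_mono) simp
    moreover have "u\<^sup>2 / 2 - 1 \<le> (real n * u\<^sup>2 / 2 - 1) / real n"
      using n by (simp add: field_simps)
    ultimately have "u\<^sup>2 / 2 - 1 \<le> (of_int j)\<^sup>2 / real n" by linarith
    then have "c * (u\<^sup>2 / 2 - 1) \<le> c * ((of_int j)\<^sup>2 / real n)"
      using assms(1) by (intro mult_left_mono) auto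
    then have "- c * (of_int j)\<^sup>2 / real n \<le> c + (- (c / 2) * u\<^sup>2)"
      by (simp add: algebra_simps)
    then have "C * exp (- c * (of_int j)\<^sup>2 / real n) \<le> C * (exp c * exp (- (c / 2) * u\<^sup>2))"
      using C unfolding exp_add[symmetric] by (intro mult_left_mono) auto
    moreover have "s i u = a n j" by (simp add: s_def n_def j_def)
    ultimately show ?thesis using bound[OF n(1), of j] by (simp add: w_def mult.assoc)
  qed
  have Gm: "G \<in> borel_measurable lborel" by simp
  note dc = Gm meas w AE_I2[OF conv] AE_I2[OF dom]
  show "integrable lborel G" by (rule integrable_dominated_convergence[OF dc])
  have "(\<lambda>i. integral\<^sup>L lborel (s i)) \<longlonglongrightarrow> integral\<^sup>L lborel G"
    by (rule integral_dominated_convergence[OF dc])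
  moreover have "integral\<^sup>L lborel (s i) = (\<Sum>j\<in>J (i + M). a (i + M) j) / sqrt (real (i + M))" for i
    unfolding s_def by (rule step_function_integral) (use supp assms(2) in \<open>auto simp: M_def\<close>)
  ultimately have "(\<lambda>i. (\<Sum>j\<in>J (i + M). a (i + M) j) / sqrt (real (i + M))) \<longlonglongrightarrow> integral\<^sup>L lborel G"
    by simp
  then show "(\<lambda>n. (\<Sum>j\<in>J n. a n j) / sqrt (real n)) \<longlonglongrightarrow> integral\<^sup>L lborel G"
    by (rule LIMSEQ_offset)
qed

section \<open>Asymptotics of the overlap weights\<close>

lemma overlap_weight_nonneg: "overlap_weight n s t \<ge> 0"
  by (simp add: overlap_weight_def)

lemma binomial_Suc_step: "real (Suc d) * real (m choose Suc d) = (real m - real d) * real (m choose d)"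
proof (cases "d \<le> m")
  case True
  have "Suc d * (m choose Suc d) = (m - d) * (m choose d)"
    using binomial_absorb_comp[of m d] binomial_absorption[of d m] by simp
  then have "real (Suc d) * real (m choose Suc d) = real (m - d) * real (m choose d)"
    unfolding of_nat_mult[symmetric] by simp
  then show ?thesis using True by (simp add: of_nat_diff)
qed (simp add: binomial_eq_0)

text \<open>One application of \<open>binomial_Suc_step\<close> to each of the two binomial
  coefficients. Without division it holds for every integer \<open>t\<close>: at
  \<open>t = -1\<close> the factor \<open>t + 1\<close> vanishes, at \<open>t = s\<close> the factor
  \<open>s - t\<close>.\<close>

lemma overlap_weight_rec:
  assumes "s \<le> n"
  shows "(of_int t + 1) * (real n - 2 * real s + of_int t + 1) * overlap_weight n s (t + 1)
    = (real s - of_int t)\<^sup>2 * overlap_weight n s t"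
proof -
  consider "t < -1" | "t = -1" | "t \<ge> int s" | "0 \<le> t" "t < int s" by linarith
  then show ?thesis
  proof cases
    case 3
    then show ?thesis by (cases "t = int s") (auto simp: overlap_weight_def binomial_eq_0)
  next
    case 4
    define u where "u = nat t"
    have u: "t = int u" "u < s" using 4 by (auto simp: u_def)
    define d where "d = s - Suc u"
    have d: "s - u = Suc d" "real s - real u = real (Suc d)" using u(2) by (auto simp: d_def)
    have 1: "(real u + 1) * real (s choose Suc u) = (real s - real u) * real (s choose u)"
      using binomial_Suc_step[of u s] by (simp add: add.commute)
    have "real (n - s) - real d = real n - 2 * real s + real u + 1"
      using assms d(2) by (simp add: of_nat_diff)
    then have 2: "(real n - 2 * real s + real u + 1) * real ((n - s) choose d) = (real s - real u) * real ((n - s) choose Suc d)"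
      using binomial_Suc_step[of d "n - s"] d(2) by simp
    have n1: "nat (int u + 1) = Suc u" by simp
    have "(real u + 1) * (real n - 2 * real s + real u + 1) * (real (s choose Suc u) * real ((n - s) choose d))
       = ((real u + 1) * real (s choose Suc u)) * ((real n - 2 * real s + real u + 1) * real ((n - s) choose d))"
      by (simp only: ac_simps)
    also have "\<dots> = (real s - real u)\<^sup>2 * (real (s choose u) * real ((n - s) choose Suc d))"
      unfolding 1 2 by (simp add: power2_eq_square)
    finally show ?thesis
      unfolding u(1) overlap_weight_def n1 d(1) d_def by (simp add: d(1)[unfolded d_def])
  qed (auto simp: overlap_weight_def)
qed

text \<open>The ratio of consecutive weights crosses 1 where \<open>(t + 1) * (n + 2) = (s + 1)\<^sup>2\<close>; see \<open>overlap_ratio_identity\<close>.\<close>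

definition overlap_mode :: "nat \<Rightarrow> nat \<Rightarrow> int" where
  "overlap_mode n s = \<lfloor>(real s + 1)\<^sup>2 / (real n + 2)\<rfloor>"

lemma overlap_mode_bounds:
  shows "of_int (overlap_mode n s) * (real n + 2) \<le> (real s + 1)\<^sup>2"
    and "(real s + 1)\<^sup>2 < (of_int (overlap_mode n s) + 1) * (real n + 2)"
proof -
  have "of_int (overlap_mode n s) \<le> (real s + 1)\<^sup>2 / (real n + 2)"
    "(real s + 1)\<^sup>2 / (real n + 2) < of_int (overlap_mode n s) + 1"
    unfolding overlap_mode_def by linarith+
  then show "of_int (overlap_mode n s) * (real n + 2) \<le> (real s + 1)\<^sup>2"
    and "(real s + 1)\<^sup>2 < (of_int (overlap_mode n s) + 1) * (real n + 2)"
    by (simp_all add: field_simps)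
qed

lemma overlap_mode_range:
  assumes "s \<le> n"
  shows "0 \<le> overlap_mode n s" "overlap_mode n s \<le> int s"
proof -
  show "0 \<le> overlap_mode n s" by (simp add: overlap_mode_def)
  have "(real s + 1)\<^sup>2 / (real n + 2) < real s + 1"
    using assms by (simp add: power2_eq_square divide_simps)
  then show "overlap_mode n s \<le> int s" unfolding overlap_mode_def by linarith
qed

text \<open>Numerator minus denominator of the ratio of consecutive weights. The terms quadratic in
  \<open>t\<close> cancel, so the difference is \<open>n + 2\<close> times the signed distance of
  \<open>t + 1\<close> from the crossing point.\<close>

lemma overlap_ratio_identity:
  fixes s t n :: real
  shows "(s - t)\<^sup>2 - (t + 1) * (n - 2 * s + t + 1) = (s + 1)\<^sup>2 - (t + 1) * (n + 2)"
  by (simp add: power2_eq_square algebra_simps)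

text \<open>With \<open>D\<close> the denominator, the ratio is at most
  \<open>1 - j * (n + 2) / D\<close>. As \<open>D \<le> (n + 2)\<^sup>2\<close>, it is at most
  \<open>1 - j / (n + 2)\<close>.\<close>

lemma overlap_weight_step_up:
  assumes "s \<le> n"
  shows "overlap_weight n s (overlap_mode n s + int j + 1)
    \<le> overlap_weight n s (overlap_mode n s + int j) * exp (- real j / (real n + 2))"
proof -
  define t where "t = overlap_mode n s + int j"
  define D where "D = (of_int t + 1) * (real n - 2 * real s + of_int t + 1)"
  show ?thesis
  proof (cases "t < int s")
    case False
    then have "overlap_weight n s (t + 1) = 0" by (simp add: overlap_weight_def binomial_eq_0)
    then show ?thesis by (simp add: t_def overlap_weight_nonneg)
  next
    case True
    have t0: "t \<ge> 0" using overlap_mode_range[OF assms] by (simp add: t_def)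
    have E: "real j * (real n + 2) \<le> (of_int t + 1) * (real n + 2) - (real s + 1)\<^sup>2"
      using overlap_mode_bounds(2)[of s n] by (simp add: t_def algebra_simps)
    have id: "(real s - of_int t)\<^sup>2 = D - ((of_int t + 1) * (real n + 2) - (real s + 1)\<^sup>2)"
      using overlap_ratio_identity[of "real s" "of_int t" "real n"] by (simp add: D_def)
    have pos: "(real s - of_int t)\<^sup>2 > 0" using True by simp
    have "0 \<le> real j * (real n + 2)" by simp
    then have D: "D > 0" using id pos E by linarith
    then have D2: "real n - 2 * real s + of_int t + 1 > 0" using t0 unfolding D_def
      by (simp add: zero_less_mult_iff)
    have "D \<le> (real n + 2) * (real n + 2)"
      unfolding D_def using t0 True assms D2 by (intro mult_mono) auto
    then have "real j * (real n + 2) / ((real n + 2) * (real n + 2)) \<le> real j * (real n + 2) / D"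
      using D by (intro divide_left_mono) auto
    also have "\<dots> \<le> ((of_int t + 1) * (real n + 2) - (real s + 1)\<^sup>2) / D"
      using E D by (intro divide_right_mono) auto
    finally have "real j / (real n + 2) \<le> ((of_int t + 1) * (real n + 2) - (real s + 1)\<^sup>2) / D"
      by simp
    moreover have "(real s - of_int t)\<^sup>2 / D = 1 - ((of_int t + 1) * (real n + 2) - (real s + 1)\<^sup>2) / D"
      unfolding id using D by (simp add: field_simps)
    moreover have "1 + (- real j / (real n + 2)) \<le> exp (- real j / (real n + 2))"
      by (rule exp_ge_add_one_self)
    ultimately have "(real s - of_int t)\<^sup>2 / D \<le> exp (- real j / (real n + 2))" by simp
    then have "overlap_weight n s t * ((real s - of_int t)\<^sup>2 / D) \<le> overlap_weight n s t * exp (- real j / (real n + 2))"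
      by (intro mult_left_mono overlap_weight_nonneg)
    moreover have "overlap_weight n s (t + 1) = overlap_weight n s t * ((real s - of_int t)\<^sup>2 / D)"
      using overlap_weight_rec[OF assms, of t, folded D_def] D by (simp add: field_simps)
    ultimately show ?thesis by (simp add: t_def)
  qed
qed

text \<open>Below the mode the inverse ratio is estimated, so \<open>(s - t)\<^sup>2\<close> is now
  the denominator to be bounded by \<open>(n + 2)\<^sup>2\<close>.\<close>

lemma overlap_weight_step_down:
  assumes "s \<le> n"
  shows "overlap_weight n s (overlap_mode n s - int j - 1)
    \<le> overlap_weight n s (overlap_mode n s - int j) * exp (- real j / (real n + 2))"
proof -
  \<comment> \<open>The lower of the two indices, so that \<open>t + 1\<close> is exactly
    \<open>j\<close> below the mode.\<close>
  define t where "t = overlap_mode n s - int j - 1"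
  define D where "D = (of_int t + 1) * (real n - 2 * real s + of_int t + 1)"
  show ?thesis
  proof (cases "t < 0")
    case True
    then have "overlap_weight n s t = 0" by (simp add: overlap_weight_def)
    then show ?thesis by (simp add: t_def overlap_weight_nonneg)
  next
    case False
    have ts: "t < int s" using overlap_mode_range[OF assms] by (simp add: t_def)
    define B where "B = (real s - of_int t)\<^sup>2"
    have E: "real j * (real n + 2) \<le> (real s + 1)\<^sup>2 - (of_int t + 1) * (real n + 2)"
      using overlap_mode_bounds(1)[of n s] by (simp add: t_def algebra_simps)
    have id: "D = B - ((real s + 1)\<^sup>2 - (of_int t + 1) * (real n + 2))"
      using overlap_ratio_identity[of "real s" "of_int t" "real n"] by (simp add: D_def B_def)
    have B: "B > 0" using ts by (simp add: B_def)
    have "B \<le> (real n + 2)\<^sup>2"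
      unfolding B_def using False ts assms by (intro power_mono) auto
    then have "real j * (real n + 2) / (real n + 2)\<^sup>2 \<le> real j * (real n + 2) / B"
      using B by (intro divide_left_mono) auto
    also have "\<dots> \<le> ((real s + 1)\<^sup>2 - (of_int t + 1) * (real n + 2)) / B"
      using E B by (intro divide_right_mono) auto
    finally have "real j / (real n + 2) \<le> ((real s + 1)\<^sup>2 - (of_int t + 1) * (real n + 2)) / B"
      by (simp add: power2_eq_square)
    moreover have "D / B = 1 - ((real s + 1)\<^sup>2 - (of_int t + 1) * (real n + 2)) / B"
      unfolding id using B by (simp add: field_simps)
    moreover have "1 + (- real j / (real n + 2)) \<le> exp (- real j / (real n + 2))"
      by (rule exp_ge_add_one_self)
    ultimately have "D / B \<le> exp (- real j / (real n + 2))" by simp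
    then have "overlap_weight n s (t + 1) * (D / B) \<le> overlap_weight n s (t + 1) * exp (- real j / (real n + 2))"
      by (intro mult_left_mono overlap_weight_nonneg)
    moreover have "overlap_weight n s t = overlap_weight n s (t + 1) * (D / B)"
      using overlap_weight_rec[OF assms, of t, folded D_def B_def] B by (simp add: field_simps)
    ultimately show ?thesis by (simp add: t_def)
  qed
qed

text \<open>The exponents add up: the sum of all \<open>i < j\<close> is
  \<open>j * (j - 1) / 2\<close>.\<close>

lemma gaussian_decay_iterate:
  fixes W :: "nat \<Rightarrow> real"
  assumes "\<And>j. W (Suc j) \<le> W j * exp (- real j / c)"
  shows "W j \<le> W 0 * exp (- (real j * (real j - 1)) / (2 * c))"
proof (induction j)
  case (Suc j)
  have "W (Suc j) \<le> W j * exp (- real j / c)" by (rule assms)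
  also have "\<dots> \<le> W 0 * exp (- (real j * (real j - 1)) / (2 * c)) * exp (- real j / c)"
    by (intro mult_right_mono Suc.IH) simp
  also have "\<dots> = W 0 * exp (- (real j * (real j - 1)) / (2 * c) + - real j / c)"
    by (simp only: exp_add mult.assoc)
  also have "- (real j * (real j - 1)) / (2 * c) + - real j / c = - (real (Suc j) * (real (Suc j) - 1)) / (2 * c)"
    by (cases "c = 0") (simp_all add: field_simps)
  finally show ?case .
qed simp

text \<open>Completing the square gives \<open>J * (J - 1) / 2 \<ge> J * J / 4 - 1\<close>. The
  constant 1/8 then comes from \<open>4 * (n + 2) \<le> 8 * n\<close>, which is where
  \<open>n \<ge> 2\<close> enters, and \<open>exp 1\<close> absorbs
  \<open>1 / (n + 2)\<close>.\<close>

lemma overlap_weight_bound: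
  assumes "s \<le> n" "n \<ge> 2"
  shows "overlap_weight n s (overlap_mode n s + j)
    \<le> overlap_weight n s (overlap_mode n s) * (exp 1 * exp (- (1/8) * (of_int j)\<^sup>2 / real n))"
proof -
  define J where "J = real_of_int \<bar>j\<bar>"
  have "overlap_weight n s (overlap_mode n s + j)
      \<le> overlap_weight n s (overlap_mode n s) * exp (- (J * (J - 1)) / (2 * (real n + 2)))"
  proof (cases "j \<ge> 0")
    case True
    then show ?thesis
      using gaussian_decay_iterate[of "\<lambda>i. overlap_weight n s (overlap_mode n s + int i)" "real n + 2" "nat j"]
        overlap_weight_step_up[OF assms(1)] by (simp add: J_def algebra_simps)
  next
    case False
    then show ?thesis
      using gaussian_decay_iterate[of "\<lambda>i. overlap_weight n s (overlap_mode n s - int i)" "real n + 2" "nat (-j)"]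
        overlap_weight_step_down[OF assms(1)] by (simp add: J_def algebra_simps)
  qed
  also have "\<dots> \<le> overlap_weight n s (overlap_mode n s) * exp (1 + (- (1/8) * (of_int j)\<^sup>2 / real n))"
  proof -
    have JJ: "(of_int j)\<^sup>2 = J * J" by (simp add: J_def power2_eq_square)
    have "(J * J / 4 - 1) / (real n + 2) \<le> (J * (J - 1) / 2) / (real n + 2)"
    proof (intro divide_right_mono)
      have "0 \<le> (J - 1)\<^sup>2" by simp
      then have "2 * J \<le> J * J + 1" by (simp add: power2_eq_square algebra_simps)
      then show "J * J / 4 - 1 \<le> J * (J - 1) / 2" by (simp add: field_simps)
    qed simp
    then have "J * J / (4 * (real n + 2)) - 1 / (real n + 2) \<le> J * (J - 1) / (2 * (real n + 2))"
      by (simp add: diff_divide_distrib)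
    moreover have "1 / (real n + 2) \<le> 1" by simp
    moreover have "J * J / (8 * real n) \<le> J * J / (4 * (real n + 2))"
      using assms(2) by (intro divide_left_mono) auto
    ultimately have "- (J * (J - 1)) / (2 * (real n + 2)) \<le> 1 + (- (1/8) * (of_int j)\<^sup>2 / real n)"
      unfolding JJ minus_divide_left[symmetric] mult_minus_left by linarith
    then show ?thesis by (intro mult_left_mono overlap_weight_nonneg) auto
  qed
  finally show ?thesis by (simp only: exp_add)
qed

text \<open>Uniformity over \<open>A n\<close> follows from convergence along every selection: select a worst index for each \<open>n\<close>.\<close>

lemma eventually_ball_choice:
  assumes "\<And>j. (\<And>n. j n \<in> A n) \<Longrightarrow> eventually (\<lambda>n. P n (j n)) F" "\<And>n. A n \<noteq> {}"
  shows "eventually (\<lambda>n. \<forall>i\<in>A n. P n i) F"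
proof -
  have "\<exists>i. i \<in> A n \<and> (P n i \<longrightarrow> (\<forall>i\<in>A n. P n i))" for n
    using assms(2)[of n] by blast
  then obtain j where j: "\<And>n. j n \<in> A n" "\<And>n. P n (j n) \<Longrightarrow> (\<forall>i\<in>A n. P n i)" by metis
  from assms(1)[OF j(1)] show ?thesis by (rule eventually_mono) (rule j(2))
qed

lemma telescope_bound:
  fixes E :: "int \<Rightarrow> real"
  assumes "\<And>i. \<bar>i\<bar> \<le> \<bar>j\<bar> \<Longrightarrow> \<bar>E (i + 1) - E i\<bar> \<le> d"
  shows "\<bar>E j - E 0\<bar> \<le> of_int \<bar>j\<bar> * d"
proof -
  have up: "\<bar>E (int k) - E 0\<bar> \<le> real k * d" if "int k \<le> \<bar>j\<bar>" for k
    using that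
  proof (induction k)
    case (Suc k)
    have "\<bar>E (int k + 1) - E (int k)\<bar> \<le> d" using Suc.prems by (intro assms) simp
    moreover have "\<bar>E (int k) - E 0\<bar> \<le> real k * d" using Suc by simp
    ultimately show ?case by (simp add: algebra_simps)
  qed simp
  have down: "\<bar>E (- int k) - E 0\<bar> \<le> real k * d" if "int k \<le> \<bar>j\<bar>" for k
    using that
  proof (induction k)
    case (Suc k)
    have "\<bar>E (- int k - 1 + 1) - E (- int k - 1)\<bar> \<le> d" using Suc.prems by (intro assms) simp
    moreover have "\<bar>E (- int k) - E 0\<bar> \<le> real k * d" using Suc by simp
    ultimately have "\<bar>E (- int k - 1) - E 0\<bar> \<le> d + real k * d" by simp
    moreover have "- int (Suc k) = - int k - 1" by simp
    ultimately have "\<bar>E (- int (Suc k)) - E 0\<bar> \<le> d + real k * d" by metis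
    then show ?case by (simp add: algebra_simps)
  qed simp
  show ?thesis using up[of "nat \<bar>j\<bar>"] down[of "nat \<bar>j\<bar>"] by (cases "j \<ge> 0") auto
qed

section \<open>Local limit of the weights on the scale \<open>sqrt n\<close> around the mode\<close>

lemma floor_scaled_tendsto: "(\<lambda>n. of_int \<lfloor>sqrt (real n) * u\<rfloor> / sqrt (real n)) \<longlonglongrightarrow> u"
proof (rule LIM_zero_cancel, rule Lim_null_comparison)
  show "\<forall>\<^sub>F n in sequentially. norm (of_int \<lfloor>sqrt (real n) * u\<rfloor> / sqrt (real n) - u) \<le> 1 / sqrt (real n)"
    using eventually_gt_at_top[of 0]
  proof eventually_elim
    case (elim n)
    have "of_int \<lfloor>sqrt (real n) * u\<rfloor> / sqrt (real n) - u
        = (of_int \<lfloor>sqrt (real n) * u\<rfloor> - sqrt (real n) * u) / sqrt (real n)"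
      using elim by (simp add: field_simps)
    moreover have "\<bar>of_int \<lfloor>sqrt (real n) * u\<rfloor> - sqrt (real n) * u\<bar> \<le> 1" by linarith
    ultimately show ?case by (simp add: divide_right_mono)
  qed
  show "(\<lambda>n. 1 / sqrt (real n)) \<longlonglongrightarrow> 0" by real_asymp
qed

text \<open>The mode is within a bounded distance of \<open>n * x\<^sup>2\<close>, the overlap with
  zero correlation. Before rounding, the difference lies between 0 and 2; the first two inequalities
  of the proof are these bounds with denominators cleared.\<close>

lemma overlap_mode_near:
  assumes "s \<le> n" "n > 0"
  shows "\<bar>of_int (overlap_mode n s) - real n * (real s / real n)\<^sup>2\<bar> \<le> 2"
proof -
  have "n * (2 * s + 1) \<le> 2 * n * (n + 2) + 2 * s\<^sup>2 \<and> 2 * s\<^sup>2 \<le> n * (2 * s + 1)"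
  proof
    have "n * (2 * s + 1) \<le> n * (2 * (n + 2))" using assms by (intro mult_left_mono) auto
    then show "n * (2 * s + 1) \<le> 2 * n * (n + 2) + 2 * s\<^sup>2" by (simp add: algebra_simps)
    have "s * s \<le> n * s" using assms by (intro mult_right_mono) auto
    moreover have "n * (2 * s + 1) = 2 * (n * s) + n" by (simp add: algebra_simps)
    ultimately show "2 * s\<^sup>2 \<le> n * (2 * s + 1)" unfolding power2_eq_square by linarith
  qed
  then have "real (n * (2 * s + 1)) \<le> real (2 * n * (n + 2) + 2 * s\<^sup>2) \<and> real (2 * s\<^sup>2) \<le> real (n * (2 * s + 1))"
    by (simp only: of_nat_le_iff)
  then have *: "0 \<le> real n * (2 * real s + 1) - 2 * (real s)\<^sup>2"
      "real n * (2 * real s + 1) - 2 * (real s)\<^sup>2 \<le> 2 * (real n * (real n + 2))"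
    by (auto simp: algebra_simps)
  have "(real s + 1)\<^sup>2 / (real n + 2) - real n * (real s / real n)\<^sup>2
      = (real n * (2 * real s + 1) - 2 * (real s)\<^sup>2) / (real n * (real n + 2))"
    using assms(2) by (simp add: field_simps power2_eq_square)
  moreover have "0 \<le> (real n * (2 * real s + 1) - 2 * (real s)\<^sup>2) / (real n * (real n + 2))"
    using *(1) assms(2) by simp
  moreover have "(real n * (2 * real s + 1) - 2 * (real s)\<^sup>2) / (real n * (real n + 2)) \<le> 2"
    using *(2) assms(2) by (simp add: divide_le_eq)
  ultimately show ?thesis unfolding overlap_mode_def by linarith
qed

definition num_ones :: "real \<Rightarrow> nat \<Rightarrow> nat" where
  "num_ones \<delta> n = nat \<lfloor>\<delta> * real n\<rfloor>"

context
  fixes \<delta> :: real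
  assumes \<delta>: "0 < \<delta>" "\<delta> < 1"
begin

private abbreviation "s \<equiv> num_ones \<delta>"
private abbreviation "mode n \<equiv> overlap_mode n (s n)"
private abbreviation "W n \<equiv> overlap_weight n (s n)"
private abbreviation "\<sigma> \<equiv> \<delta> * (1 - \<delta>)"

lemma num_ones_le: "s n \<le> n"
proof -
  have "\<delta> * real n \<le> 1 * real n" using \<delta> by (intro mult_right_mono) auto
  then show ?thesis unfolding num_ones_def by linarith
qed

lemma num_ones_near: "n > 0 \<Longrightarrow> \<bar>real (s n) / real n - \<delta>\<bar> \<le> 1 / real n"
proof -
  assume n: "n > 0"
  have "0 \<le> \<delta> * real n" using \<delta> by simp
  then have "\<bar>real (s n) - \<delta> * real n\<bar> \<le> 1" unfolding num_ones_def by linarith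
  then have "\<bar>real (s n) - \<delta> * real n\<bar> / real n \<le> 1 / real n" by (rule divide_right_mono) simp
  moreover have "\<bar>real (s n) - \<delta> * real n\<bar> / real n = \<bar>real (s n) / real n - \<delta>\<bar>"
  proof -
    have "real (s n) / real n - \<delta> = (real (s n) - \<delta> * real n) / real n" using n by (simp add: field_simps)
    then show ?thesis by simp
  qed
  ultimately show ?thesis by simp
qed

lemma num_ones_tendsto: "(\<lambda>n. real (s n) / real n) \<longlonglongrightarrow> \<delta>"
proof (rule LIM_zero_cancel, rule Lim_null_comparison)
  show "\<forall>\<^sub>F n in sequentially. norm (real (s n) / real n - \<delta>) \<le> 1 / real n"
    using eventually_gt_at_top[of 0] by eventually_elim (use num_ones_near in simp)
  show "(\<lambda>n. 1 / real n) \<longlonglongrightarrow> 0" by real_asymp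
qed

lemma overlap_mode_tendsto:
  assumes "\<And>n. \<bar>real_of_int (j n)\<bar> \<le> M * sqrt (real n)"
  shows "(\<lambda>n. of_int (mode n + j n) / real n) \<longlonglongrightarrow> \<delta>\<^sup>2"
proof -
  have "(\<lambda>n. of_int (mode n + j n) / real n - (real (s n) / real n)\<^sup>2) \<longlonglongrightarrow> 0"
  proof (rule Lim_null_comparison)
    show "\<forall>\<^sub>F n in sequentially. norm (of_int (mode n + j n) / real n - (real (s n) / real n)\<^sup>2) \<le> (2 + M * sqrt (real n)) / real n"
      using eventually_gt_at_top[of 0]
    proof eventually_elim
      case (elim n)
      have "of_int (mode n + j n) / real n - (real (s n) / real n)\<^sup>2
          = ((of_int (mode n) - real n * (real (s n) / real n)\<^sup>2) + of_int (j n)) / real n"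
        using elim by (simp add: field_simps)
      moreover have "\<bar>(of_int (mode n) - real n * (real (s n) / real n)\<^sup>2) + of_int (j n)\<bar> \<le> 2 + M * sqrt (real n)"
        using overlap_mode_near[OF num_ones_le elim] assms[of n] by linarith
      ultimately show ?case by (simp add: divide_right_mono)
    qed
    show "(\<lambda>n. (2 + M * sqrt (real n)) / real n) \<longlonglongrightarrow> 0" by real_asymp
  qed
  from tendsto_add[OF this tendsto_power[OF num_ones_tendsto, of 2]] show ?thesis by simp
qed

text \<open>The weight is positive when \<open>0 \<le> t \<le> s\<close> and
  \<open>s - t \<le> n - s\<close>. Divided by \<open>n\<close>, the three slacks tend to
  \<open>\<delta>\<^sup>2\<close>, \<open>\<delta> - \<delta>\<^sup>2\<close> and
  \<open>(1 - \<delta>)\<^sup>2\<close>, all positive.\<close>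

lemma overlap_weight_eventually_pos:
  assumes "(\<lambda>n. of_int (t n) / real n) \<longlonglongrightarrow> \<delta>\<^sup>2"
  shows "\<forall>\<^sub>F n in sequentially. W n (t n) > 0"
proof -
  have "\<forall>\<^sub>F n in sequentially. of_int (t n) / real n > 0"
    using order_tendstoD(1)[OF assms, of 0] \<delta> by simp
  moreover have "(\<lambda>n. real (s n) / real n - of_int (t n) / real n) \<longlonglongrightarrow> \<delta> - \<delta>\<^sup>2"
    by (intro tendsto_intros assms num_ones_tendsto)
  then have "\<forall>\<^sub>F n in sequentially. real (s n) / real n - of_int (t n) / real n > 0"
    by (rule order_tendstoD(1)) (use \<delta> in \<open>simp add: power2_eq_square\<close>)
  moreover have "(\<lambda>n. 1 - 2 * (real (s n) / real n) + of_int (t n) / real n) \<longlonglongrightarrow> 1 - 2 * \<delta> + \<delta>\<^sup>2"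
    by (intro tendsto_intros assms num_ones_tendsto)
  then have "\<forall>\<^sub>F n in sequentially. 1 - 2 * (real (s n) / real n) + of_int (t n) / real n > 0"
  proof (rule order_tendstoD(1))
    have "0 < (1 - \<delta>)\<^sup>2" using \<delta> by simp
    then show "0 < 1 - 2 * \<delta> + \<delta>\<^sup>2" by (simp add: power2_eq_square algebra_simps)
  qed
  ultimately show ?thesis using eventually_gt_at_top[of 0]
  proof eventually_elim
    case (elim n)
    have t: "t n > 0" using elim(1,4) by (simp add: zero_less_divide_iff)
    have "real_of_int (t n) < real (s n)"
      using elim(2,4) by (simp add: diff_divide_distrib[symmetric] zero_less_divide_iff)
    then have ts: "nat (t n) \<le> s n" using t by linarith
    have "1 - 2 * (real (s n) / real n) + of_int (t n) / real n = (real n - 2 * real (s n) + of_int (t n)) / real n"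
      using elim(4) by (simp add: field_simps)
    then have "real n - 2 * real (s n) + of_int (t n) > 0" using elim(3,4) by (simp add: zero_less_divide_iff)
    then have "s n - nat (t n) \<le> n - s n" using t ts num_ones_le[of n] by linarith
    then show ?case using t ts by (simp add: overlap_weight_def)
  qed
qed

text \<open>The ratio of consecutive weights is \<open>1 - y n\<close>, where \<open>y n\<close> is
  approximately \<open>j n / (n * \<sigma>\<^sup>2)\<close> and of order at most
  \<open>1 / sqrt n\<close>. The factor \<open>sqrt n\<close> in the statement is the precision
  needed for summing over about \<open>sqrt n\<close> steps.\<close>

lemma overlap_weight_log_ratio:
  assumes j: "\<And>n. \<bar>real_of_int (j n)\<bar> \<le> M * sqrt (real n)"
  shows "(\<lambda>n. sqrt (real n) * (ln (W n (mode n + j n + 1)) - ln (W n (mode n + j n))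
      + of_int (j n) / (real n * \<sigma>\<^sup>2))) \<longlonglongrightarrow> 0"
proof -
  define t where "t n = mode n + j n" for n
  define D where "D n = (of_int (t n) + 1) * (real n - 2 * real (s n) + of_int (t n) + 1)" for n
  define v where "v n = of_int (j n) / sqrt (real n)" for n
  \<comment> \<open>The rounding error in the mode, between 0 and 1.\<close>
  define \<theta> where "\<theta> n = of_int (mode n) + 1 - (real (s n) + 1)\<^sup>2 / (real n + 2)" for n
  define K where "K n = (real n + 2) * real n / D n" for n
  define y where "y n = (of_int (j n) + \<theta> n) * (real n + 2) / D n" for n
  have \<sigma>: "\<sigma> > 0" using \<delta> by simp
  have t: "(\<lambda>n. of_int (t n) / real n) \<longlonglongrightarrow> \<delta>\<^sup>2"
    unfolding t_def by (rule overlap_mode_tendsto[OF j])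
  have inv: "(\<lambda>n. 1 / real n) \<longlonglongrightarrow> 0" by real_asymp
  have t1: "(\<lambda>n. of_int (t n + 1) / real n) \<longlonglongrightarrow> \<delta>\<^sup>2"
    using tendsto_add[OF t inv] by (simp add: add_divide_distrib)
  have "(\<lambda>n. (of_int (t n) / real n + 1 / real n) * (1 - 2 * (real (s n) / real n) + of_int (t n) / real n + 1 / real n))
      \<longlonglongrightarrow> (\<delta>\<^sup>2 + 0) * (1 - 2 * \<delta> + \<delta>\<^sup>2 + 0)"
    by (intro tendsto_intros t inv num_ones_tendsto)
  also have "(\<delta>\<^sup>2 + 0) * (1 - 2 * \<delta> + \<delta>\<^sup>2 + 0) = \<sigma>\<^sup>2" by (simp add: power2_eq_square algebra_simps)
  finally have "(\<lambda>n. D n / (real n)\<^sup>2) \<longlonglongrightarrow> \<sigma>\<^sup>2"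
    by (rule Lim_transform_eventually)
      (use eventually_gt_at_top[of 0] in eventually_elim, simp add: D_def power2_eq_square field_simps)
  note D = this
  have Dpos: "\<forall>\<^sub>F n in sequentially. D n > 0"
  proof -
    have "\<forall>\<^sub>F n in sequentially. D n / (real n)\<^sup>2 > 0"
      by (rule order_tendstoD(1)[OF D]) (use \<delta> in simp)
    then show ?thesis by eventually_elim (auto simp: zero_less_divide_iff)
  qed
  have "(\<lambda>n. (1 + 2 * (1 / real n)) / (D n / (real n)\<^sup>2)) \<longlonglongrightarrow> (1 + 2 * 0) / \<sigma>\<^sup>2"
    using \<sigma> by (intro tendsto_intros inv D) auto
  then have "(\<lambda>n. (1 + 2 * (1 / real n)) / (D n / (real n)\<^sup>2)) \<longlonglongrightarrow> 1 / \<sigma>\<^sup>2" by simp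
  then have K: "K \<longlonglongrightarrow> 1 / \<sigma>\<^sup>2"
    by (rule Lim_transform_eventually)
      (use eventually_gt_at_top[of 0] Dpos in eventually_elim, simp add: K_def power2_eq_square field_simps)
  have v: "\<bar>v n\<bar> \<le> M" if "n > 0" for n
    using j[of n] that by (simp add: v_def abs_divide divide_le_eq)
  have \<theta>: "\<bar>\<theta> n\<bar> \<le> 1" for n
    unfolding \<theta>_def overlap_mode_def by linarith
  have \<theta>0: "(\<lambda>n. \<theta> n / sqrt (real n)) \<longlonglongrightarrow> 0"
  proof (rule Lim_null_comparison)
    show "\<forall>\<^sub>F n in sequentially. norm (\<theta> n / sqrt (real n)) \<le> 1 / sqrt (real n)"
      using \<theta> by (auto simp: abs_divide intro!: divide_right_mono always_eventually)
    show "(\<lambda>n. 1 / sqrt (real n)) \<longlonglongrightarrow> 0" by real_asymp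
  qed
  have vK: "(\<lambda>n. v n * (K n - 1 / \<sigma>\<^sup>2)) \<longlonglongrightarrow> 0"
  proof (rule Lim_null_comparison)
    show "\<forall>\<^sub>F n in sequentially. norm (v n * (K n - 1 / \<sigma>\<^sup>2)) \<le> M * \<bar>K n - 1 / \<sigma>\<^sup>2\<bar>"
      using eventually_gt_at_top[of 0] by eventually_elim (use v in \<open>auto simp: abs_mult intro!: mult_right_mono\<close>)
    have "(\<lambda>n. M * \<bar>K n - 1 / \<sigma>\<^sup>2\<bar>) \<longlonglongrightarrow> M * \<bar>1 / \<sigma>\<^sup>2 - 1 / \<sigma>\<^sup>2\<bar>"
      by (intro tendsto_intros K)
    then show "(\<lambda>n. M * \<bar>K n - 1 / \<sigma>\<^sup>2\<bar>) \<longlonglongrightarrow> 0" by simp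
  qed
  have sy: "\<forall>\<^sub>F n in sequentially. sqrt (real n) * y n = (v n + \<theta> n / sqrt (real n)) * K n"
    using eventually_gt_at_top[of 0]
  proof eventually_elim
    case (elim n)
    have alg: "q * ((a + b) * c / d) = (a / q + b / q) * (c * (q * q) / d)" if "q \<noteq> 0" for a b c d q :: real
      using that by (cases "d = 0") (simp_all add: field_simps)
    show ?case
      using alg[of "sqrt (real n)" "of_int (j n)" "\<theta> n" "real n + 2" "D n"] elim
      by (simp add: y_def v_def K_def)
  qed
  have "(\<lambda>n. v n * (K n - 1 / \<sigma>\<^sup>2) + \<theta> n / sqrt (real n) * K n) \<longlonglongrightarrow> 0 + 0 * (1 / \<sigma>\<^sup>2)"
    by (intro tendsto_intros vK \<theta>0 K)
  then have "(\<lambda>n. v n * (K n - 1 / \<sigma>\<^sup>2) + \<theta> n / sqrt (real n) * K n) \<longlonglongrightarrow> 0" by simp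
  then have lin: "(\<lambda>n. sqrt (real n) * y n - v n / \<sigma>\<^sup>2) \<longlonglongrightarrow> 0"
    by (rule Lim_transform_eventually) (use sy in eventually_elim, simp add: algebra_simps)
  have isq: "(\<lambda>n. 1 / sqrt (real n)) \<longlonglongrightarrow> 0" by real_asymp
  have v0: "(\<lambda>n. v n / \<sigma>\<^sup>2 * (1 / sqrt (real n))) \<longlonglongrightarrow> 0"
  proof (rule Lim_null_comparison)
    show "\<forall>\<^sub>F n in sequentially. norm (v n / \<sigma>\<^sup>2 * (1 / sqrt (real n))) \<le> M / \<sigma>\<^sup>2 * (1 / sqrt (real n))"
      using eventually_gt_at_top[of 0]
    proof eventually_elim
      case (elim n)
      have "norm (v n / \<sigma>\<^sup>2 * (1 / sqrt (real n))) = \<bar>v n\<bar> / \<sigma>\<^sup>2 * (1 / sqrt (real n))"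
        by (simp add: abs_mult abs_divide)
      also have "\<dots> \<le> M / \<sigma>\<^sup>2 * (1 / sqrt (real n))"
        using v[OF elim] by (intro mult_right_mono divide_right_mono) auto
      finally show ?case .
    qed
    show "(\<lambda>n. M / \<sigma>\<^sup>2 * (1 / sqrt (real n))) \<longlonglongrightarrow> 0" using tendsto_mult_right_zero[OF isq] .
  qed
  have "(\<lambda>n. (sqrt (real n) * y n - v n / \<sigma>\<^sup>2) * (1 / sqrt (real n)) + v n / \<sigma>\<^sup>2 * (1 / sqrt (real n))) \<longlonglongrightarrow> 0 * 0 + 0"
    by (intro tendsto_intros lin isq v0)
  then have "(\<lambda>n. (sqrt (real n) * y n - v n / \<sigma>\<^sup>2) * (1 / sqrt (real n)) + v n / \<sigma>\<^sup>2 * (1 / sqrt (real n))) \<longlonglongrightarrow> 0" by simp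
  then have y0: "y \<longlonglongrightarrow> 0"
    by (rule Lim_transform_eventually)
      (use eventually_gt_at_top[of 0] in eventually_elim, simp add: diff_divide_distrib)
  have yb: "\<forall>\<^sub>F n in sequentially. \<bar>y n\<bar> < 1/2"
    using order_tendstoD[OF y0, of "1/2"] order_tendstoD[OF y0, of "-1/2"]
    by (auto elim: eventually_elim2)
  \<comment> \<open>The logarithm differs from \<open>- y n\<close> by at most twice its square;
    since \<open>sqrt n * y n\<close> is bounded, one factor \<open>y n\<close> is left to tend to
    0.\<close>
  have quad: "(\<lambda>n. sqrt (real n) * (ln (1 - y n) + y n)) \<longlonglongrightarrow> 0"
  proof (rule Lim_null_comparison)
    show "\<forall>\<^sub>F n in sequentially. norm (sqrt (real n) * (ln (1 - y n) + y n))
        \<le> 2 * (\<bar>sqrt (real n) * y n - v n / \<sigma>\<^sup>2\<bar> + M / \<sigma>\<^sup>2) * \<bar>y n\<bar>"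
      using yb eventually_gt_at_top[of 0]
    proof eventually_elim
      case (elim n)
      have "\<bar>ln (1 + - y n) - (- y n)\<bar> \<le> 2 * (- y n)\<^sup>2"
        using elim by (intro abs_ln_one_plus_x_minus_x_bound) simp
      then have "norm (sqrt (real n) * (ln (1 - y n) + y n)) \<le> sqrt (real n) * (2 * \<bar>y n\<bar>\<^sup>2)"
        by (simp add: abs_mult mult_left_mono)
      also have "\<dots> = 2 * \<bar>sqrt (real n) * y n\<bar> * \<bar>y n\<bar>" by (simp add: abs_mult power2_eq_square)
      also have "\<dots> \<le> 2 * (\<bar>sqrt (real n) * y n - v n / \<sigma>\<^sup>2\<bar> + M / \<sigma>\<^sup>2) * \<bar>y n\<bar>"
      proof -
        have "\<bar>v n / \<sigma>\<^sup>2\<bar> \<le> M / \<sigma>\<^sup>2" using v[OF elim(2)] by (simp add: abs_divide divide_right_mono)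
        then have "\<bar>sqrt (real n) * y n\<bar> \<le> \<bar>sqrt (real n) * y n - v n / \<sigma>\<^sup>2\<bar> + M / \<sigma>\<^sup>2" by linarith
        then show ?thesis by (intro mult_right_mono mult_left_mono) auto
      qed
      finally show ?case .
    qed
    have "(\<lambda>n. 2 * (\<bar>sqrt (real n) * y n - v n / \<sigma>\<^sup>2\<bar> + M / \<sigma>\<^sup>2) * \<bar>y n\<bar>) \<longlonglongrightarrow> 2 * (\<bar>0\<bar> + M / \<sigma>\<^sup>2) * \<bar>0\<bar>"
      by (intro tendsto_intros lin y0)
    then show "(\<lambda>n. 2 * (\<bar>sqrt (real n) * y n - v n / \<sigma>\<^sup>2\<bar> + M / \<sigma>\<^sup>2) * \<bar>y n\<bar>) \<longlonglongrightarrow> 0" by simp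
  qed
  have "(\<lambda>n. sqrt (real n) * (ln (1 - y n) + y n) - (sqrt (real n) * y n - v n / \<sigma>\<^sup>2)) \<longlonglongrightarrow> 0 - 0"
    by (intro tendsto_intros quad lin)
  then have main: "(\<lambda>n. sqrt (real n) * (ln (1 - y n) + y n) - (sqrt (real n) * y n - v n / \<sigma>\<^sup>2)) \<longlonglongrightarrow> 0" by simp
  show ?thesis
  proof (rule Lim_transform_eventually[OF main])
    show "\<forall>\<^sub>F n in sequentially. sqrt (real n) * (ln (1 - y n) + y n) - (sqrt (real n) * y n - v n / \<sigma>\<^sup>2)
       = sqrt (real n) * (ln (W n (mode n + j n + 1)) - ln (W n (mode n + j n)) + of_int (j n) / (real n * \<sigma>\<^sup>2))"
      using Dpos overlap_weight_eventually_pos[OF t] overlap_weight_eventually_pos[OF t1] eventually_gt_at_top[of 0]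
    proof eventually_elim
      case (elim n)
      have num: "(of_int (j n) + \<theta> n) * (real n + 2) = (of_int (t n) + 1) * (real n + 2) - (real (s n) + 1)\<^sup>2"
      proof -
        have "real n + 2 \<noteq> 0" using of_nat_0_le_iff[of n, where 'a = real] by linarith
        then have "(real (s n) + 1)\<^sup>2 / (real n + 2) * (real n + 2) = (real (s n) + 1)\<^sup>2" by simp
        moreover have "of_int (j n) + \<theta> n = of_int (t n) + 1 - (real (s n) + 1)\<^sup>2 / (real n + 2)"
          by (simp add: t_def \<theta>_def)
        ultimately show ?thesis by (simp only: left_diff_distrib)
      qed
      have "(real (s n) - of_int (t n))\<^sup>2 = D n - (of_int (j n) + \<theta> n) * (real n + 2)"
        unfolding num using overlap_ratio_identity[of "real (s n)" "of_int (t n)" "real n"] by (simp add: D_def)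
      then have y: "(real (s n) - of_int (t n))\<^sup>2 / D n = 1 - y n"
        using elim(1) by (simp add: y_def diff_divide_distrib)
      have "D n * W n (t n + 1) = (real (s n) - of_int (t n))\<^sup>2 * W n (t n)"
        using overlap_weight_rec[OF num_ones_le[of n], of "t n"] by (simp add: D_def)
      then have "W n (t n + 1) / W n (t n) = (real (s n) - of_int (t n))\<^sup>2 / D n"
        using elim by (simp add: frac_eq_eq mult.commute)
      then have "1 - y n = W n (t n + 1) / W n (t n)" using y by simp
      then have lnr: "ln (1 - y n) = ln (W n (t n + 1)) - ln (W n (t n))"
        using elim by (simp add: ln_div)
      have vs: "v n / \<sigma>\<^sup>2 = sqrt (real n) * (of_int (j n) / (real n * \<sigma>\<^sup>2))"
      proof -
        define q where "q = sqrt (real n)"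
        have q: "q > 0" "real n = q * q" using elim(4) by (auto simp: q_def)
        show ?thesis unfolding v_def q_def[symmetric] q(2) using q(1) by simp
      qed
      show ?case unfolding t_def[symmetric] lnr vs by (simp add: algebra_simps)
    qed
  qed
qed

text \<open>Summing the logarithmic ratios from the mode gives
  \<open>- f * (f - 1) / (2 * n * \<sigma>\<^sup>2)\<close> with \<open>f\<close> close to
  \<open>sqrt n * u\<close>. The errors are uniformly small over the at most
  \<open>M * sqrt n\<close> steps, by \<open>eventually_ball_choice\<close>.\<close>

lemma overlap_weight_local_limit:
  "(\<lambda>n. W n (mode n + \<lfloor>sqrt (real n) * u\<rfloor>) / W n (mode n)) \<longlonglongrightarrow> exp (- (u\<^sup>2 / (2 * \<sigma>\<^sup>2)))"
proof -
  \<comment> \<open>The extra 1 covers the rounding error, since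
    \<open>1 \<le> sqrt n\<close>.\<close>
  define M where "M = \<bar>u\<bar> + 1"
  define A where "A n = {j. \<bar>real_of_int j\<bar> \<le> M * sqrt (real n)}" for n
  define L where "L n j = ln (W n (mode n + j))" for n j
  define f where "f n = \<lfloor>sqrt (real n) * u\<rfloor>" for n
  have M: "M > 0" by (simp add: M_def)
  have A0: "0 \<in> A n" for n using M by (simp add: A_def)
  have fA: "f n \<in> A n" if "n > 0" for n
  proof -
    have "\<bar>real_of_int (f n)\<bar> \<le> \<bar>sqrt (real n) * u\<bar> + 1" unfolding f_def by linarith
    moreover have "1 \<le> sqrt (real n)" using that by simp
    moreover have "\<bar>sqrt (real n) * u\<bar> + sqrt (real n) = M * sqrt (real n)"
      by (simp add: M_def abs_mult algebra_simps)
    ultimately show ?thesis unfolding A_def by (intro CollectI) linarith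
  qed
  have pos: "\<forall>\<^sub>F n in sequentially. \<forall>j\<in>A n. W n (mode n + j) > 0"
  proof (rule eventually_ball_choice)
    fix j :: "nat \<Rightarrow> int" assume "\<And>n. j n \<in> A n"
    then show "\<forall>\<^sub>F n in sequentially. W n (mode n + j n) > 0"
      by (intro overlap_weight_eventually_pos overlap_mode_tendsto[of _ M]) (auto simp: A_def)
  qed (use A0 in auto)
  have step: "\<forall>\<^sub>F n in sequentially. \<forall>j\<in>A n.
      \<bar>sqrt (real n) * (L n (j + 1) - L n j + of_int j / (real n * \<sigma>\<^sup>2))\<bar> < e" if "e > 0" for e
  proof (rule eventually_ball_choice)
    fix j :: "nat \<Rightarrow> int" assume "\<And>n. j n \<in> A n"
    then have "(\<lambda>n. sqrt (real n) * (L n (j n + 1) - L n (j n) + of_int (j n) / (real n * \<sigma>\<^sup>2))) \<longlonglongrightarrow> 0"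
      unfolding L_def using overlap_weight_log_ratio[of j M] by (simp add: A_def add.assoc)
    from tendstoD[OF this that] show "\<forall>\<^sub>F n in sequentially.
        \<bar>sqrt (real n) * (L n (j n + 1) - L n (j n) + of_int (j n) / (real n * \<sigma>\<^sup>2))\<bar> < e"
      by (simp add: dist_real_def)
  qed (use A0 in auto)
  define R where "R n = of_int (f n) * (of_int (f n) - 1) / (2 * real n * \<sigma>\<^sup>2)" for n
  have "(\<lambda>n. L n (f n) - L n 0 + R n) \<longlonglongrightarrow> 0"
  proof (rule tendstoI)
    fix e :: real assume e: "e > 0"
    define e' where "e' = e / (2 * M)"
    have "e' > 0" using e M by (simp add: e'_def)
    from step[OF this] eventually_gt_at_top[of 0]
    show "\<forall>\<^sub>F n in sequentially. dist (L n (f n) - L n 0 + R n) 0 < e"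
    proof eventually_elim
      case (elim n)
      \<comment> \<open>Adding the expected parabola makes each increment of \<open>E\<close> the
        error controlled by \<open>step\<close>.\<close>
      define E where "E j = L n j + of_int j * (of_int j - 1) / (2 * real n * \<sigma>\<^sup>2)" for j
      have sq: "sqrt (real n) > 0" using elim by simp
      have "\<bar>E (f n) - E 0\<bar> \<le> of_int \<bar>f n\<bar> * (e' / sqrt (real n))"
      proof (rule telescope_bound)
        fix i assume i: "\<bar>i\<bar> \<le> \<bar>f n\<bar>"
        have "\<bar>real_of_int i\<bar> \<le> \<bar>real_of_int (f n)\<bar>" using i by linarith
        then have "i \<in> A n" using fA[OF elim(2)] by (simp add: A_def)
        then have "\<bar>sqrt (real n) * (L n (i + 1) - L n i + of_int i / (real n * \<sigma>\<^sup>2))\<bar> < e'"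
          using elim by blast
        moreover have "E (i + 1) - E i = L n (i + 1) - L n i + of_int i / (real n * \<sigma>\<^sup>2)"
        proof -
          have "of_int (i + 1) * (of_int (i + 1) - 1) / (2 * real n * \<sigma>\<^sup>2) - of_int i * (of_int i - 1) / (2 * real n * \<sigma>\<^sup>2)
             = (2 * of_int i) / (2 * (real n * \<sigma>\<^sup>2))"
            unfolding diff_divide_distrib[symmetric] by (simp add: algebra_simps)
          also have "\<dots> = of_int i / (real n * \<sigma>\<^sup>2)" by (rule mult_divide_mult_cancel_left) simp
          finally show ?thesis unfolding E_def by linarith
        qed
        ultimately show "\<bar>E (i + 1) - E i\<bar> \<le> e' / sqrt (real n)"
          using sq by (simp add: abs_mult pos_le_divide_eq mult.commute)
      qed
      also have "\<dots> = (\<bar>real_of_int (f n)\<bar> / sqrt (real n)) * e'" by simp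
      also have "\<dots> \<le> M * e'"
        using fA[OF elim(2)] sq \<open>e' > 0\<close> by (intro mult_right_mono) (auto simp: A_def pos_divide_le_eq)
      also have "\<dots> < e" using e M by (simp add: e'_def)
      finally show ?case by (simp add: E_def R_def dist_real_def)
    qed
  qed
  moreover have "R \<longlonglongrightarrow> u\<^sup>2 / (2 * \<sigma>\<^sup>2)"
  proof -
    have isq: "(\<lambda>n. 1 / sqrt (real n)) \<longlonglongrightarrow> 0" by real_asymp
    have "\<sigma>\<^sup>2 \<noteq> 0" using \<delta> by simp
    then have "(\<lambda>n. of_int (f n) / sqrt (real n) * (of_int (f n) / sqrt (real n) - 1 / sqrt (real n)) / (2 * \<sigma>\<^sup>2))
       \<longlonglongrightarrow> u * (u - 0) / (2 * \<sigma>\<^sup>2)"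
      unfolding f_def by (intro tendsto_intros floor_scaled_tendsto isq) simp
    moreover have "of_int (f n) / sqrt (real n) * (of_int (f n) / sqrt (real n) - 1 / sqrt (real n)) / (2 * \<sigma>\<^sup>2) = R n" for n
      by (simp add: R_def diff_divide_distrib[symmetric] ac_simps)
    ultimately show ?thesis by (simp add: power2_eq_square)
  qed
  ultimately have "(\<lambda>n. (L n (f n) - L n 0 + R n) - R n) \<longlonglongrightarrow> 0 - u\<^sup>2 / (2 * \<sigma>\<^sup>2)"
    by (rule tendsto_diff)
  then have "(\<lambda>n. exp (L n (f n) - L n 0)) \<longlonglongrightarrow> exp (- (u\<^sup>2 / (2 * \<sigma>\<^sup>2)))"
    by (intro tendsto_exp) simp
  then show ?thesis
  proof (rule Lim_transform_eventually)
    show "\<forall>\<^sub>F n in sequentially. exp (L n (f n) - L n 0) = W n (mode n + \<lfloor>sqrt (real n) * u\<rfloor>) / W n (mode n)"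
      using pos eventually_gt_at_top[of 0]
    proof eventually_elim
      case (elim n)
      have "W n (mode n + f n) > 0" "W n (mode n + 0) > 0" using elim fA A0 by blast+
      then show ?case by (simp add: L_def exp_diff f_def)
    qed
  qed
qed

end

section \<open>The limit of the moment ratio\<close>

text \<open>Take logarithms: \<open>m * (ln (1 + e) - e)\<close> is at most
  \<open>2 * m * e * e\<close> in absolute value, where \<open>m * e\<close> converges and
  \<open>e\<close> tends to 0.\<close>

lemma one_plus_power_tendsto:
  fixes e :: "nat \<Rightarrow> real" and m :: "nat \<Rightarrow> nat"
  assumes e: "e \<longlonglongrightarrow> 0" and me: "(\<lambda>n. real (m n) * e n) \<longlonglongrightarrow> l"
  shows "(\<lambda>n. (1 + e n) ^ m n) \<longlonglongrightarrow> exp l"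
proof -
  have small: "\<forall>\<^sub>F n in sequentially. \<bar>e n\<bar> < 1/2"
    using tendstoD[OF e, of "1/2"] by simp
  have "(\<lambda>n. real (m n) * (ln (1 + e n) - e n)) \<longlonglongrightarrow> 0"
  proof (rule Lim_null_comparison)
    show "\<forall>\<^sub>F n in sequentially. norm (real (m n) * (ln (1 + e n) - e n)) \<le> 2 * \<bar>real (m n) * e n\<bar> * \<bar>e n\<bar>"
      using small
    proof eventually_elim
      case (elim n)
      have "\<bar>ln (1 + e n) - e n\<bar> \<le> 2 * (e n)\<^sup>2"
        using elim by (intro abs_ln_one_plus_x_minus_x_bound) simp
      then have "real (m n) * \<bar>ln (1 + e n) - e n\<bar> \<le> real (m n) * (2 * \<bar>e n\<bar>\<^sup>2)"
        by (intro mult_left_mono) auto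
      then show ?case by (simp add: abs_mult power2_eq_square)
    qed
    have "(\<lambda>n. 2 * \<bar>real (m n) * e n\<bar> * \<bar>e n\<bar>) \<longlonglongrightarrow> 2 * \<bar>l\<bar> * \<bar>0\<bar>"
      by (intro tendsto_intros e me)
    then show "(\<lambda>n. 2 * \<bar>real (m n) * e n\<bar> * \<bar>e n\<bar>) \<longlonglongrightarrow> 0" by simp
  qed
  from tendsto_exp[OF tendsto_add[OF this me]]
  have "(\<lambda>n. exp (real (m n) * ln (1 + e n))) \<longlonglongrightarrow> exp l"
    by (simp add: algebra_simps)
  then show ?thesis
  proof (rule Lim_transform_eventually)
    show "\<forall>\<^sub>F n in sequentially. exp (real (m n) * ln (1 + e n)) = (1 + e n) ^ m n"
      using small by eventually_elim (auto simp: exp_of_nat_mult exp_ln)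
  qed
qed

lemma abs_one_plus_power_le: "\<bar>(1 + e) ^ m\<bar> \<le> exp (real m * \<bar>e :: real\<bar>)"
proof -
  have "\<bar>1 + e\<bar> \<le> exp \<bar>e\<bar>" using exp_ge_add_one_self[of "\<bar>e\<bar>"] by linarith
  then have "\<bar>1 + e\<bar> ^ m \<le> exp \<bar>e\<bar> ^ m" by (intro power_mono) auto
  then show ?thesis by (simp add: power_abs exp_of_nat_mult)
qed

text \<open>The derivative is continuous, hence bounded, on the unit interval. Applied to the
  derivative of the satisfaction probability, this quantifies how far \<open>s / n\<close> is from
  being critical.\<close>

lemma funpow_avg_lipschitz:
  "\<exists>K\<ge>0. \<forall>x\<in>{0..1}. \<forall>y\<in>{0..1}. \<bar>(avg x ^^ k) f a - (avg y ^^ k) f a\<bar> \<le> K * \<bar>x - y\<bar>"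
proof -
  let ?d = "\<lambda>x. real k * (avg x ^^ (k - 1)) (fdiff f) a"
  have "compact (?d ` {0..1})"
    by (intro compact_continuous_image continuous_intros funpow_avg_continuous) simp
  from compact_imp_bounded[OF this] obtain K where "\<forall>v\<in>?d ` {0..1}. norm v \<le> K"
    unfolding bounded_iff by blast
  then have K: "\<And>x. x \<in> {0..1} \<Longrightarrow> \<bar>?d x\<bar> \<le> K" by simp
  have "K \<ge> 0" using K[of 0] by (rule order_trans[OF abs_ge_zero]) simp
  moreover have "norm ((avg x ^^ k) f a - (avg y ^^ k) f a) \<le> K * norm (x - y)"
    if "x \<in> {0..1}" "y \<in> {0..1}" for x y
  proof (rule field_differentiable_bound[where S = "{0..1}" and f' = ?d])
    show "((\<lambda>x. (avg x ^^ k) f a) has_field_derivative ?d z) (at z within {0..1})" for z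
      using funpow_avg_derivative has_field_derivative_at_within by blast
  qed (use K that in auto)
  ultimately show ?thesis by auto
qed

section \<open>Expansion of the pair probability in the covariance\<close>

definition pair_tail :: "nat \<Rightarrow> real \<Rightarrow> real \<Rightarrow> (nat \<Rightarrow> real) \<Rightarrow> real" where
  "pair_tail k x z f = (\<Sum>j\<le>k - 2. real (k choose (j + 2)) * (z ^ j * (mixed x (k - 2 - j) (j + 2) f)\<^sup>2))"

text \<open>Splits off the terms of degree 0 and 1 in \<open>z\<close>. By
  \<open>funpow_avg_derivative\<close> the linear coefficient vanishes exactly at the critical
  points of the binomial expectation of \<open>f\<close>.\<close>

lemma pair_poly_expand:
  assumes "k \<ge> 2"
  shows "pair_poly k x z f f = ((avg x ^^ k) f 0)\<^sup>2 + real k * z * ((avg x ^^ (k - 1)) (fdiff f) 0)\<^sup>2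
    + z\<^sup>2 * pair_tail k x z f"
proof -
  obtain l where l: "k = Suc (Suc l)" using assms by (metis add_2_eq_Suc le_Suc_ex)
  define T where "T j = real (k choose j) * (z ^ j * (mixed x (k - j) j f * mixed x (k - j) j f))" for j
  have "pair_poly k x z f f = T 0 + (T (Suc 0) + (\<Sum>j\<le>l. T (Suc (Suc j))))"
    unfolding pair_poly_def T_def[symmetric] by (simp only: l sum.atMost_Suc_shift)
  moreover have "T 0 = ((avg x ^^ k) f 0)\<^sup>2" by (simp add: T_def mixed_def power2_eq_square)
  moreover have "T (Suc 0) = real k * z * ((avg x ^^ (k - 1)) (fdiff f) 0)\<^sup>2"
    unfolding T_def mixed_def by (simp add: power2_eq_square)
  moreover have "(\<Sum>j\<le>l. T (Suc (Suc j))) = z\<^sup>2 * pair_tail k x z f"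
    unfolding pair_tail_def sum_distrib_left by (rule sum.cong) (auto simp: l T_def power2_eq_square)
  ultimately show ?thesis by simp
qed

lemma pair_tail_tendsto:
  assumes "x \<longlonglongrightarrow> \<delta>" "z \<longlonglongrightarrow> \<zeta>"
  shows "(\<lambda>n. pair_tail k (x n) (z n) f) \<longlonglongrightarrow> pair_tail k \<delta> \<zeta> f"
proof -
  have "(\<lambda>n. mixed (x n) a b f) \<longlonglongrightarrow> mixed \<delta> a b f" for a b
    unfolding mixed_def using isCont_tendsto_compose[OF DERIV_isCont[OF funpow_avg_derivative] assms(1)] .
  then show ?thesis unfolding pair_tail_def by (intro tendsto_intros assms)
qed

text \<open>The coefficients are nonnegative, being multiples of squares, so the polynomial is
  largest at 1. This makes bounds uniform in \<open>z\<close>.\<close>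

lemma abs_pair_tail_le:
  assumes "\<bar>z\<bar> \<le> 1"
  shows "\<bar>pair_tail k x z f\<bar> \<le> pair_tail k x 1 f"
  unfolding pair_tail_def
proof (rule order_trans[OF sum_abs sum_mono])
  fix j
  have "\<bar>z\<bar> ^ j * ((mixed x (k - 2 - j) (j + 2) f)\<^sup>2) \<le> 1 * (mixed x (k - 2 - j) (j + 2) f)\<^sup>2"
    using assms by (intro mult_right_mono power_le_one) auto
  then show "\<bar>real (k choose (j + 2)) * (z ^ j * (mixed x (k - 2 - j) (j + 2) f)\<^sup>2)\<bar>
      \<le> real (k choose (j + 2)) * (1 ^ j * (mixed x (k - 2 - j) (j + 2) f)\<^sup>2)"
    by (simp add: abs_mult power_abs mult_left_mono)
qed

text \<open>Recentres at the mode. The window from \<open>-n\<close> to \<open>n\<close> does not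
  depend on the mode, yet contains every shift with nonzero weight.\<close>

lemma sum_overlap_shift:
  fixes \<phi> :: "int \<Rightarrow> real"
  assumes "s \<le> n"
  shows "(\<Sum>t\<in>{0..int s}. overlap_weight n s t * \<phi> t)
    = (\<Sum>j\<in>{- int n..int n}. overlap_weight n s (overlap_mode n s + j) * \<phi> (overlap_mode n s + j))"
proof -
  let ?m = "overlap_mode n s"
  have "(\<Sum>j\<in>{- int n..int n}. overlap_weight n s (?m + j) * \<phi> (?m + j))
      = (\<Sum>t\<in>{?m - int n..?m + int n}. overlap_weight n s t * \<phi> t)"
    by (rule sum.reindex_bij_witness[of _ "\<lambda>t. t - ?m" "\<lambda>j. ?m + j"]) auto
  also have "\<dots> = (\<Sum>t\<in>{0..int s}. overlap_weight n s t * \<phi> t)"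
    by (rule sum.mono_neutral_right)
      (use overlap_mode_range[OF assms] assms in \<open>auto simp: overlap_weight_def binomial_eq_0\<close>)
  finally show ?thesis ..
qed

text \<open>Dividing both sums of \<open>moment_ratio\<close> by the weight at the mode and by
  \<open>sqrt n\<close> leaves sums of \<open>a1\<close> and of \<open>a2\<close>, where
  \<open>a2\<close> carries the factor \<open>(1 + e) ^ m\<close>.
  \<open>scaled_sum_tendsto_integral\<close> applies to each.\<close>

lemma moment_ratio_tendsto:
  fixes \<delta> :: real and I :: "nat set" and k :: nat
  assumes \<delta>: "0 < \<delta>" "\<delta> < 1" and k: "k \<ge> 2"
    and crit: "(avg \<delta> ^^ (k - 1)) (fdiff (member_ind I)) 0 = 0"
    and ppos: "\<And>x. 0 < x \<Longrightarrow> x < 1 \<Longrightarrow> (avg x ^^ k) (member_ind I) 0 > 0"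
  shows "\<exists>rstar>0. \<forall>r. 0 < r \<and> r < rstar \<longrightarrow> (\<exists>L>0.
    (\<lambda>n. (measure_pmf.expectation (random_instance k (nat \<lfloor>r * real n\<rfloor>) n)
             (\<lambda>F. real (num_delta_solutions I \<delta> n F)))\<^sup>2
        / measure_pmf.expectation (random_instance k (nat \<lfloor>r * real n\<rfloor>) n)
             (\<lambda>F. (real (num_delta_solutions I \<delta> n F))\<^sup>2)) \<longlonglongrightarrow> L)"
proof -
  define f where "f = member_ind I"
  define s where "s = num_ones \<delta>"
  define x where "x n = real (s n) / real n" for n
  define p where "p y = (avg y ^^ k) f 0" for y
  define \<mu> where "\<mu> y = (avg y ^^ (k - 1)) (fdiff f) 0" for y
  define W where "W n = overlap_weight n (s n)" for n
  define mo where "mo n = overlap_mode n (s n)" for n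
  define z where "z n j = of_int (mo n + j) / real n - (x n)\<^sup>2" for n j
  define A where "A n = real k * (\<mu> (x n))\<^sup>2 / (p (x n))\<^sup>2" for n
  define B where "B n w = pair_tail k (x n) w f / (p (x n))\<^sup>2" for n w
  define e where "e n j = A n * z n j + (z n j)\<^sup>2 * B n (z n j)" for n j
  define \<sigma> where "\<sigma> = \<delta> * (1 - \<delta>)"
  define \<beta> where "\<beta> = pair_tail k \<delta> 0 f / (p \<delta>)\<^sup>2"
  have sn: "s n \<le> n" for n unfolding s_def by (rule num_ones_le[OF \<delta>])
  have xlim: "x \<longlonglongrightarrow> \<delta>" unfolding x_def s_def by (rule num_ones_tendsto[OF \<delta>])
  have x01: "0 \<le> x n" "x n \<le> 1" for n
    using sn[of n] by (auto simp: x_def divide_le_eq)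
  have xpos: "\<forall>\<^sub>F n in sequentially. 0 < x n" "\<forall>\<^sub>F n in sequentially. x n < 1"
    using order_tendstoD[OF xlim] \<delta> by auto
  have p\<delta>: "p \<delta> > 0" using ppos[OF \<delta>] by (simp add: p_def f_def)
  have plim: "(\<lambda>n. p (x n)) \<longlonglongrightarrow> p \<delta>"
    unfolding p_def using isCont_tendsto_compose[OF DERIV_isCont[OF funpow_avg_derivative] xlim] .
  have nearmode: "\<bar>of_int (mo n) - real n * (x n)\<^sup>2\<bar> \<le> 2" if "n > 0" for n
    unfolding mo_def x_def by (rule overlap_mode_near[OF sn that])
  have zeq: "z n j = (of_int (mo n) - real n * (x n)\<^sup>2 + of_int j) / real n" if "n > 0" for n j
    using that by (simp add: z_def field_simps)
  define K1P where "K1P = 1 / (p \<delta>)\<^sup>2 + 1"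
  have invp: "(\<lambda>n. 1 / (p (x n))\<^sup>2) \<longlonglongrightarrow> 1 / (p \<delta>)\<^sup>2"
    using p\<delta> by (intro tendsto_intros plim) auto
  have invp_le: "\<forall>\<^sub>F n in sequentially. 1 / (p (x n))\<^sup>2 < K1P"
    by (rule order_tendstoD(2)[OF invp]) (simp add: K1P_def)
  obtain Kl where Kl: "Kl \<ge> 0" "\<And>y. y \<in> {0..1} \<Longrightarrow> \<bar>\<mu> y - \<mu> \<delta>\<bar> \<le> Kl * \<bar>y - \<delta>\<bar>"
    using funpow_avg_lipschitz[of "k - 1" "fdiff f" 0] \<delta> unfolding \<mu>_def by (metis atLeastAtMost_iff less_imp_le)
  have \<mu>0: "\<mu> \<delta> = 0" using crit by (simp add: \<mu>_def f_def)
  define K1 where "K1 = real k * Kl\<^sup>2 * K1P"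
  have A0: "A n \<ge> 0" for n by (simp add: A_def)
  \<comment> \<open>\<open>\<mu>\<close> vanishes at \<open>\<delta>\<close>, is Lipschitz, and
    \<open>x n\<close> is within \<open>1 / n\<close> of \<open>\<delta>\<close>. The resulting
    order \<open>1 / n\<close> of \<open>A n\<close> keeps \<open>m * A n\<close> bounded.\<close>
  have Ale: "\<forall>\<^sub>F n in sequentially. A n \<le> K1 / real n"
    using invp_le eventually_gt_at_top[of 0]
  proof eventually_elim
    case (elim n)
    have "\<bar>x n - \<delta>\<bar> \<le> 1 / real n" unfolding x_def s_def by (rule num_ones_near[OF \<delta> elim(2)])
    then have "Kl * \<bar>x n - \<delta>\<bar> \<le> Kl * (1 / real n)" using Kl(1) by (intro mult_left_mono)
    then have "\<bar>\<mu> (x n)\<bar> \<le> Kl / real n" using Kl(2)[of "x n"] x01[of n] \<mu>0 by simp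
    then have "\<bar>\<mu> (x n)\<bar>\<^sup>2 \<le> (Kl / real n)\<^sup>2" by (intro power_mono) auto
    also have "\<dots> = Kl\<^sup>2 / real n * (1 / real n)" by (simp add: power2_eq_square)
    also have "\<dots> \<le> Kl\<^sup>2 / real n * 1" using elim(2) by (intro mult_left_mono) auto
    finally have "(\<mu> (x n))\<^sup>2 \<le> Kl\<^sup>2 / real n" by simp
    then have "real k * (\<mu> (x n))\<^sup>2 * (1 / (p (x n))\<^sup>2) \<le> real k * (Kl\<^sup>2 / real n) * K1P"
      using elim(1) by (intro mult_mono mult_left_mono) auto
    then show ?case by (simp add: A_def K1_def)
  qed
  have K1: "K1 \<ge> 0" by (simp add: K1_def K1P_def)
  define K2 where "K2 = \<bar>pair_tail k \<delta> 1 f / (p \<delta>)\<^sup>2\<bar> + 1"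
  have K2: "K2 > 0" unfolding K2_def by linarith
  have "(\<lambda>n. pair_tail k (x n) 1 f / (p (x n))\<^sup>2) \<longlonglongrightarrow> pair_tail k \<delta> 1 f / (p \<delta>)\<^sup>2"
    using p\<delta> by (intro tendsto_intros plim pair_tail_tendsto xlim) auto
  then have Bt: "\<forall>\<^sub>F n in sequentially. pair_tail k (x n) 1 f / (p (x n))\<^sup>2 < K2"
    by (rule order_tendstoD(2)) (unfold K2_def, linarith)
  have Ble: "\<forall>\<^sub>F n in sequentially. \<forall>w. \<bar>w\<bar> \<le> 1 \<longrightarrow> \<bar>B n w\<bar> \<le> K2"
    using Bt
  proof eventually_elim
    case (elim n)
    show ?case
    proof (intro allI impI)
      fix w :: real assume "\<bar>w\<bar> \<le> 1"
      then have "\<bar>pair_tail k (x n) w f\<bar> / (p (x n))\<^sup>2 \<le> pair_tail k (x n) 1 f / (p (x n))\<^sup>2"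
        by (intro divide_right_mono abs_pair_tail_le) auto
      then show "\<bar>B n w\<bar> \<le> K2" using elim by (simp add: B_def)
    qed
  qed
  have "\<forall>\<^sub>F n in sequentially. W n (mo n) > 0"
    unfolding W_def mo_def s_def
    using overlap_weight_eventually_pos[OF \<delta> overlap_mode_tendsto[OF \<delta>, of "\<lambda>_. 0" 0]] by simp
  with xpos Ale Ble eventually_ge_at_top[of 2]
  have "\<forall>\<^sub>F n in sequentially. 0 < x n \<and> x n < 1 \<and> A n \<le> K1 / real n
     \<and> (\<forall>w. \<bar>w\<bar> \<le> 1 \<longrightarrow> \<bar>B n w\<bar> \<le> K2) \<and> 2 \<le> n \<and> W n (mo n) > 0"
    by eventually_elim blast
  \<comment> \<open>Domination needs all these bounds simultaneously from one index on.\<close>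
  then obtain N where N: "\<And>n. n \<ge> N \<Longrightarrow> 0 < x n \<and> x n < 1 \<and> A n \<le> K1 / real n
     \<and> (\<forall>w. \<bar>w\<bar> \<le> 1 \<longrightarrow> \<bar>B n w\<bar> \<le> K2) \<and> 2 \<le> n \<and> W n (mo n) > 0"
    unfolding eventually_sequentially by blast
  define a1 where "a1 n j = W n (mo n + j) / W n (mo n)" for n j
  define G1 where "G1 u = exp (- (u\<^sup>2 / (2 * \<sigma>\<^sup>2)))" for u :: real
  have W0: "W n t = 0" if "t < 0 \<or> t > int (s n)" for n t
    using that by (auto simp: W_def overlap_weight_def binomial_eq_0)
  have mo: "0 \<le> mo n" "mo n \<le> int (s n)" for n
    unfolding mo_def using overlap_mode_range[OF sn] by auto
  have a1_supp: "a1 n j = 0" if "j \<notin> {- int n..int n}" for n j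
  proof -
    have "mo n + j < 0 \<or> mo n + j > int (s n)" using that mo[of n] sn[of n] by auto
    then show ?thesis by (simp add: a1_def W0)
  qed
  have a1_nn: "a1 n j \<ge> 0" for n j by (simp add: a1_def W_def overlap_weight_nonneg)
  have a1_bound: "a1 n j \<le> exp 1 * exp (- (1/8) * (of_int j)\<^sup>2 / real n)" if "n \<ge> N" for n j
  proof -
    have "W n (mo n + j) \<le> W n (mo n) * (exp 1 * exp (- (1/8) * (of_int j)\<^sup>2 / real n))"
      unfolding W_def mo_def using N[OF that] by (intro overlap_weight_bound sn) auto
    then show ?thesis using N[OF that] by (simp add: a1_def pos_divide_le_eq mult.commute)
  qed
  have a1_lim: "(\<lambda>n. a1 n \<lfloor>sqrt (real n) * u\<rfloor>) \<longlonglongrightarrow> G1 u" for u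
    unfolding a1_def G1_def W_def mo_def s_def \<sigma>_def by (rule overlap_weight_local_limit[OF \<delta>])
  have G1m: "G1 \<in> borel_measurable borel" unfolding G1_def by measurable
  have abs_a1: "\<bar>a1 n j\<bar> \<le> exp 1 * exp (- (1/8) * (of_int j)\<^sup>2 / real n)" if "n \<ge> N" for n j
    using a1_bound[OF that] a1_nn by simp
  have c8: "(1/8 :: real) > 0" by simp
  have J: "finite {- int n..int n}" for n by simp
  have I1: "integrable lborel G1"
    by (rule scaled_sum_tendsto_integral(1)[OF c8 J a1_supp abs_a1 a1_lim G1m])
  have L1: "(\<lambda>n. (\<Sum>j\<in>{- int n..int n}. a1 n j) / sqrt (real n)) \<longlonglongrightarrow> integral\<^sup>L lborel G1"
    by (rule scaled_sum_tendsto_integral(2)[OF c8 J a1_supp abs_a1 a1_lim G1m])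
  have zlim: "(\<lambda>n. sqrt (real n) * z n \<lfloor>sqrt (real n) * u\<rfloor>) \<longlonglongrightarrow> u" for u
  proof -
    have "(\<lambda>n. (of_int (mo n) - real n * (x n)\<^sup>2) / sqrt (real n)) \<longlonglongrightarrow> 0"
    proof (rule Lim_null_comparison)
      show "\<forall>\<^sub>F n in sequentially. norm ((of_int (mo n) - real n * (x n)\<^sup>2) / sqrt (real n)) \<le> 2 / sqrt (real n)"
        using eventually_gt_at_top[of 0]
        by eventually_elim (use nearmode in \<open>auto simp: abs_divide intro!: divide_right_mono\<close>)
      show "(\<lambda>n. 2 / sqrt (real n)) \<longlonglongrightarrow> 0" by real_asymp
    qed
    from tendsto_add[OF this floor_scaled_tendsto[of u]]
    have "(\<lambda>n. (of_int (mo n) - real n * (x n)\<^sup>2) / sqrt (real n) + of_int \<lfloor>sqrt (real n) * u\<rfloor> / sqrt (real n)) \<longlonglongrightarrow> u"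
      by simp
    then show ?thesis
    proof (rule Lim_transform_eventually)
      show "\<forall>\<^sub>F n in sequentially. (of_int (mo n) - real n * (x n)\<^sup>2) / sqrt (real n) + of_int \<lfloor>sqrt (real n) * u\<rfloor> / sqrt (real n)
          = sqrt (real n) * z n \<lfloor>sqrt (real n) * u\<rfloor>"
        using eventually_gt_at_top[of 0]
      proof eventually_elim
        case (elim n)
        have "sqrt (real n) / real n = 1 / sqrt (real n)"
          using elim by (simp add: divide_eq_eq real_div_sqrt)
        then show ?case unfolding zeq[OF elim] add_divide_distrib[symmetric]
          by (metis (no_types, opaque_lifting) mult.commute mult_1 times_divide_eq_left times_divide_eq_right)
      qed
    qed
  qed
  have z0: "(\<lambda>n. z n \<lfloor>sqrt (real n) * u\<rfloor>) \<longlonglongrightarrow> 0" for u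
  proof -
    have "(\<lambda>n. 1 / sqrt (real n)) \<longlonglongrightarrow> 0" by real_asymp
    from tendsto_mult[OF zlim[of u] this]
    have "(\<lambda>n. sqrt (real n) * z n \<lfloor>sqrt (real n) * u\<rfloor> * (1 / sqrt (real n))) \<longlonglongrightarrow> 0" by simp
    then show ?thesis
      by (rule Lim_transform_eventually) (use eventually_gt_at_top[of 0] in eventually_elim, simp)
  qed
  \<comment> \<open>The weights decay like \<open>exp (- j\<^sup>2 / (8 * n))\<close> while
    \<open>m * \<bar>e\<bar>\<close> grows at most like \<open>2 * r * K2 * j\<^sup>2 / n\<close>.
    Below the threshold \<open>1 / (32 * K2)\<close> the growth uses at most half of the decay,
    leaving the rate 1/16.\<close>
  show ?thesis
  proof (rule exI[of _ "1 / (32 * K2)"], intro conjI allI impI)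
    show "1 / (32 * K2) > 0" using K2 by simp
    fix r :: real assume r: "0 < r \<and> r < 1 / (32 * K2)"
    define m where "m n = nat \<lfloor>r * real n\<rfloor>" for n
    have m_le: "real (m n) \<le> r * real n" for n
    proof -
      have "0 \<le> r * real n" using r by simp
      then show ?thesis unfolding m_def by linarith
    qed
    have mlim: "(\<lambda>n. real (m n) / real n) \<longlonglongrightarrow> r"
    proof (rule LIM_zero_cancel, rule Lim_null_comparison)
      show "\<forall>\<^sub>F n in sequentially. norm (real (m n) / real n - r) \<le> 1 / real n"
        using eventually_gt_at_top[of 0]
      proof eventually_elim
        case (elim n)
        have "0 \<le> r * real n" using r by simp
        then have "\<bar>real (m n) - r * real n\<bar> \<le> 1" unfolding m_def by linarith
        then have "\<bar>real (m n) - r * real n\<bar> / real n \<le> 1 / real n" by (intro divide_right_mono) auto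
        moreover have "real (m n) / real n - r = (real (m n) - r * real n) / real n" using elim by (simp add: field_simps)
        ultimately show ?case by simp
      qed
      show "(\<lambda>n. 1 / real n) \<longlonglongrightarrow> 0" by real_asymp
    qed
    define g where "g n j = (1 + e n j) ^ m n" for n j
    define C2 where "C2 = exp 1 * exp (r * K1 + 8 * r * K2)"
    define a2 where "a2 n j = a1 n j * g n j" for n j
    define G2 where "G2 u = G1 u * exp (r * \<beta> * u\<^sup>2)" for u
    have a2_supp: "a2 n j = 0" if "j \<notin> {- int n..int n}" for n j
      using a1_supp[OF that] by (simp add: a2_def)
    have a2_bound: "\<bar>a2 n j\<bar> \<le> C2 * exp (- (1/16) * (of_int j)\<^sup>2 / real n)" if nN: "n \<ge> N" for n j
    \<comment> \<open>Only for overlaps between 0 and \<open>s n\<close> is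
      \<open>\<bar>z n j\<bar> \<le> 1\<close> ensured, as the bound \<open>K2\<close> requires;
      elsewhere \<open>a1\<close> vanishes.\<close>
    proof (cases "a1 n j = 0")
      case True
      then show ?thesis by (simp add: a2_def C2_def)
    next
      case False
      have n: "n > 0" "n \<ge> 2" using N[OF nN] by auto
      have "\<not> (mo n + j < 0 \<or> mo n + j > int (s n))"
        using False W0[of "mo n + j" n] by (auto simp: a1_def)
      then have t: "0 \<le> real_of_int (mo n + j)" "real_of_int (mo n + j) \<le> real n" using sn[of n] by linarith+
      then have "0 \<le> of_int (mo n + j) / real n" "of_int (mo n + j) / real n \<le> 1" using n by (auto simp: divide_le_eq)
      moreover have "0 \<le> (x n)\<^sup>2" "(x n)\<^sup>2 \<le> 1" using x01[of n] by (auto simp: power_le_one)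
      ultimately have z1: "\<bar>z n j\<bar> \<le> 1" unfolding z_def by linarith
      have "\<bar>z n j\<bar> \<le> (2 + \<bar>of_int j\<bar>) / real n"
        unfolding zeq[OF n(1)] using nearmode[OF n(1)] by (auto simp: abs_divide intro!: divide_right_mono)
      then have "\<bar>z n j\<bar>\<^sup>2 \<le> ((2 + \<bar>of_int j\<bar>) / real n)\<^sup>2" by (intro power_mono) auto
      then have "real n * (z n j)\<^sup>2 \<le> real n * ((2 + \<bar>of_int j\<bar>) / real n)\<^sup>2" by (intro mult_left_mono) auto
      also have "\<dots> = (2 + \<bar>of_int j\<bar>)\<^sup>2 / real n" using n by (simp add: power2_eq_square field_simps)
      also have "\<dots> \<le> (8 + 2 * (of_int j)\<^sup>2) / real n"
      proof (intro divide_right_mono)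
        have "0 \<le> (2 - \<bar>real_of_int j\<bar>)\<^sup>2" by simp
        then show "(2 + \<bar>real_of_int j\<bar>)\<^sup>2 \<le> 8 + 2 * (of_int j)\<^sup>2" by (simp add: power2_sum power2_diff)
      qed simp
      also have "\<dots> \<le> 8 + 2 * ((of_int j)\<^sup>2 / real n)" using n by (simp add: add_divide_distrib divide_le_eq)
      finally have nz: "real n * (z n j)\<^sup>2 \<le> 8 + 2 * ((of_int j)\<^sup>2 / real n)" .
      have "\<bar>e n j\<bar> \<le> A n * \<bar>z n j\<bar> + (z n j)\<^sup>2 * \<bar>B n (z n j)\<bar>"
        unfolding e_def using abs_triangle_ineq[of "A n * z n j" "(z n j)\<^sup>2 * B n (z n j)"] A0[of n] by (simp add: abs_mult)
      also have "\<dots> \<le> K1 / real n * 1 + (z n j)\<^sup>2 * K2"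
        using N[OF nN] z1 A0 K1 by (intro add_mono mult_mono mult_left_mono) auto
      finally have "\<bar>e n j\<bar> \<le> K1 / real n + (z n j)\<^sup>2 * K2" by simp
      then have "real (m n) * \<bar>e n j\<bar> \<le> (r * real n) * (K1 / real n + (z n j)\<^sup>2 * K2)"
        using m_le[of n] r by (intro mult_mono) auto
      also have "\<dots> = r * K1 + r * K2 * (real n * (z n j)\<^sup>2)" using n by (simp add: field_simps)
      also have "\<dots> \<le> r * K1 + r * K2 * (8 + 2 * ((of_int j)\<^sup>2 / real n))"
        using nz r K2 by (intro add_left_mono mult_left_mono) auto
      also have "\<dots> = r * K1 + 8 * r * K2 + (2 * r * K2) * ((of_int j)\<^sup>2 / real n)" by (simp add: algebra_simps)
      also have "\<dots> \<le> r * K1 + 8 * r * K2 + (1/16) * ((of_int j)\<^sup>2 / real n)"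
      proof -
        have "r * (32 * K2) \<le> 1" using r K2 by (simp add: pos_less_divide_eq less_imp_le)
        then have "2 * r * K2 \<le> 1/16" by simp
        then show ?thesis by (intro add_left_mono mult_right_mono) auto
      qed
      finally have "\<bar>g n j\<bar> \<le> exp (r * K1 + 8 * r * K2 + (1/16) * ((of_int j)\<^sup>2 / real n))"
        unfolding g_def using abs_one_plus_power_le order_trans by (meson exp_le_cancel_iff)
      then have "\<bar>a2 n j\<bar> \<le> exp 1 * exp (- (1/8) * (of_int j)\<^sup>2 / real n)
          * exp (r * K1 + 8 * r * K2 + (1/16) * ((of_int j)\<^sup>2 / real n))"
        unfolding a2_def abs_mult using abs_a1[OF nN] by (intro mult_mono) auto
      also have "\<dots> = C2 * exp (- (1/16) * (of_int j)\<^sup>2 / real n)"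
        unfolding C2_def by (simp add: exp_add[symmetric] algebra_simps)
      finally show ?thesis .
    qed
    have a2_lim: "(\<lambda>n. a2 n \<lfloor>sqrt (real n) * u\<rfloor>) \<longlonglongrightarrow> G2 u" for u
    proof -
      define \<zeta> where "\<zeta> n = z n \<lfloor>sqrt (real n) * u\<rfloor>" for n
      have \<zeta>0: "\<zeta> \<longlonglongrightarrow> 0" unfolding \<zeta>_def by (rule z0)
      have \<zeta>u: "(\<lambda>n. sqrt (real n) * \<zeta> n) \<longlonglongrightarrow> u" unfolding \<zeta>_def by (rule zlim)
      have Blim: "(\<lambda>n. B n (\<zeta> n)) \<longlonglongrightarrow> \<beta>"
        unfolding B_def \<beta>_def using p\<delta> by (intro tendsto_intros plim pair_tail_tendsto xlim \<zeta>0) auto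
      have Alim: "(\<lambda>n. real (m n) * (A n * \<zeta> n)) \<longlonglongrightarrow> 0"
      proof (rule Lim_null_comparison)
        show "\<forall>\<^sub>F n in sequentially. norm (real (m n) * (A n * \<zeta> n)) \<le> r * K1 * \<bar>\<zeta> n\<bar>"
          using Ale eventually_gt_at_top[of 0]
        proof eventually_elim
          case (elim n)
          have "real (m n) * A n \<le> (r * real n) * (K1 / real n)"
            using m_le[of n] elim r A0[of n] by (intro mult_mono) auto
          also have "\<dots> = r * K1" using elim by simp
          finally have "real (m n) * A n * \<bar>\<zeta> n\<bar> \<le> r * K1 * \<bar>\<zeta> n\<bar>" by (intro mult_right_mono) auto
          then show ?case using A0[of n] by (simp add: abs_mult mult.assoc)
        qed
        show "(\<lambda>n. r * K1 * \<bar>\<zeta> n\<bar>) \<longlonglongrightarrow> 0"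
          using tendsto_mult_right_zero[OF tendsto_rabs_zero[OF \<zeta>0]] .
      qed
      have A0lim: "A \<longlonglongrightarrow> 0"
      proof (rule Lim_null_comparison)
        show "\<forall>\<^sub>F n in sequentially. norm (A n) \<le> K1 / real n"
          using Ale by eventually_elim (use A0 in simp)
        show "(\<lambda>n. K1 / real n) \<longlonglongrightarrow> 0" by real_asymp
      qed
      have "(\<lambda>n. A n * \<zeta> n + (\<zeta> n)\<^sup>2 * B n (\<zeta> n)) \<longlonglongrightarrow> 0 * 0 + 0\<^sup>2 * \<beta>"
        by (intro tendsto_intros A0lim \<zeta>0 Blim)
      then have e0: "(\<lambda>n. A n * \<zeta> n + (\<zeta> n)\<^sup>2 * B n (\<zeta> n)) \<longlonglongrightarrow> 0" by simp
      \<comment> \<open>Splitting \<open>m * \<zeta>\<^sup>2\<close> as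
        \<open>(m / n) * (sqrt n * \<zeta>)\<^sup>2\<close> exposes two convergent factors; only
        this quadratic term survives in the limit.\<close>
      have "(\<lambda>n. real (m n) * (A n * \<zeta> n) + real (m n) / real n * (sqrt (real n) * \<zeta> n)\<^sup>2 * B n (\<zeta> n)) \<longlonglongrightarrow> 0 + r * u\<^sup>2 * \<beta>"
        by (intro tendsto_intros Alim mlim \<zeta>u Blim)
      then have "(\<lambda>n. real (m n) * (A n * \<zeta> n) + real (m n) / real n * (sqrt (real n) * \<zeta> n)\<^sup>2 * B n (\<zeta> n)) \<longlonglongrightarrow> r * \<beta> * u\<^sup>2"
        by (simp add: ac_simps)
      then have "(\<lambda>n. real (m n) * (A n * \<zeta> n + (\<zeta> n)\<^sup>2 * B n (\<zeta> n))) \<longlonglongrightarrow> r * \<beta> * u\<^sup>2"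
        by (rule Lim_transform_eventually)
          (use eventually_gt_at_top[of 0] in eventually_elim, simp add: power_mult_distrib algebra_simps)
      from one_plus_power_tendsto[OF e0 this]
      have "(\<lambda>n. g n \<lfloor>sqrt (real n) * u\<rfloor>) \<longlonglongrightarrow> exp (r * \<beta> * u\<^sup>2)"
        by (simp add: g_def e_def \<zeta>_def)
      then show ?thesis unfolding a2_def G2_def by (intro tendsto_mult a1_lim)
    qed
    have G2m: "G2 \<in> borel_measurable borel" unfolding G2_def using G1m by measurable
    have c16: "(1/16 :: real) > 0" by simp
    have I2: "integrable lborel G2"
      by (rule scaled_sum_tendsto_integral(1)[OF c16 J a2_supp a2_bound a2_lim G2m])
    have L2: "(\<lambda>n. (\<Sum>j\<in>{- int n..int n}. a2 n j) / sqrt (real n)) \<longlonglongrightarrow> integral\<^sup>L lborel G2"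
      by (rule scaled_sum_tendsto_integral(2)[OF c16 J a2_supp a2_bound a2_lim G2m])
    have P1: "integral\<^sup>L lborel G1 > 0" by (rule lborel_integral_pos[OF I1]) (simp add: G1_def)
    have P2: "integral\<^sup>L lborel G2 > 0" by (rule lborel_integral_pos[OF I2]) (simp add: G2_def G1_def)
    have lim: "(\<lambda>n. ((\<Sum>j\<in>{- int n..int n}. a1 n j) / sqrt (real n)) / ((\<Sum>j\<in>{- int n..int n}. a2 n j) / sqrt (real n)))
       \<longlonglongrightarrow> integral\<^sup>L lborel G1 / integral\<^sup>L lborel G2"
      using P2 by (intro tendsto_divide L1 L2) simp
    show "\<exists>L>0. (\<lambda>n. (measure_pmf.expectation (random_instance k (nat \<lfloor>r * real n\<rfloor>) n)
             (\<lambda>F. real (num_delta_solutions I \<delta> n F)))\<^sup>2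
        / measure_pmf.expectation (random_instance k (nat \<lfloor>r * real n\<rfloor>) n)
             (\<lambda>F. (real (num_delta_solutions I \<delta> n F))\<^sup>2)) \<longlonglongrightarrow> L"
    proof (intro exI conjI)
      show "integral\<^sup>L lborel G1 / integral\<^sup>L lborel G2 > 0" using P1 P2 by simp
      show "(\<lambda>n. (measure_pmf.expectation (random_instance k (nat \<lfloor>r * real n\<rfloor>) n)
             (\<lambda>F. real (num_delta_solutions I \<delta> n F)))\<^sup>2
        / measure_pmf.expectation (random_instance k (nat \<lfloor>r * real n\<rfloor>) n)
             (\<lambda>F. (real (num_delta_solutions I \<delta> n F))\<^sup>2)) \<longlonglongrightarrow> integral\<^sup>L lborel G1 / integral\<^sup>L lborel G2"
      proof (rule Lim_transform_eventually[OF lim])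
        show "\<forall>\<^sub>F n in sequentially. ((\<Sum>j\<in>{- int n..int n}. a1 n j) / sqrt (real n)) / ((\<Sum>j\<in>{- int n..int n}. a2 n j) / sqrt (real n))
          = (measure_pmf.expectation (random_instance k (nat \<lfloor>r * real n\<rfloor>) n)
             (\<lambda>F. real (num_delta_solutions I \<delta> n F)))\<^sup>2
            / measure_pmf.expectation (random_instance k (nat \<lfloor>r * real n\<rfloor>) n)
             (\<lambda>F. (real (num_delta_solutions I \<delta> n F))\<^sup>2)"
          using eventually_ge_at_top[of N]
        proof eventually_elim
          case (elim n)
          have n: "n > 0" and Wm: "W n (mo n) > 0" using N[OF elim] by auto
          have px: "p (x n) > 0" unfolding p_def f_def using N[OF elim] by (intro ppos) auto
          let ?q = "\<lambda>t. pair_poly k (x n) (of_int t / real n - (x n)\<^sup>2) f f / (p (x n))\<^sup>2"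
          have q: "?q (mo n + j) = 1 + e n j" for j
            unfolding pair_poly_expand[OF k] z_def[symmetric] p_def[symmetric] \<mu>_def[symmetric]
            using px by (simp add: e_def A_def B_def add_divide_distrib ac_simps)
          \<comment> \<open>Both sums carry the factor \<open>W n (mo n)\<close>, which cancels in
            the quotient, so its asymptotics never enter.\<close>
          have S1: "(\<Sum>t\<in>{0..int (s n)}. W n t) = W n (mo n) * (\<Sum>j\<in>{- int n..int n}. a1 n j)"
            using sum_overlap_shift[OF sn, of n "\<lambda>_. 1"] Wm
            by (simp add: a1_def W_def mo_def sum_distrib_left)
          have S2: "(\<Sum>t\<in>{0..int (s n)}. W n t * ?q t ^ m n) = W n (mo n) * (\<Sum>j\<in>{- int n..int n}. a2 n j)"
            unfolding W_def sum_overlap_shift[OF sn, of n "\<lambda>t. ?q t ^ m n"] sum_distrib_left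
            unfolding mo_def[symmetric] q using Wm
            by (intro sum.cong) (auto simp: a1_def a2_def g_def W_def)
          have "(measure_pmf.expectation (random_instance k (m n) n) (\<lambda>F. real (num_delta_solutions I \<delta> n F)))\<^sup>2
              / measure_pmf.expectation (random_instance k (m n) n) (\<lambda>F. (real (num_delta_solutions I \<delta> n F))\<^sup>2)
             = (\<Sum>t\<in>{0..int (s n)}. W n t) / (\<Sum>t\<in>{0..int (s n)}. W n t * ?q t ^ m n)"
            using moment_ratio[of n \<delta> k I "m n"] n \<delta> px
            by (simp add: s_def num_ones_def[symmetric] x_def p_def f_def W_def)
          also have "\<dots> = (\<Sum>j\<in>{- int n..int n}. a1 n j) / (\<Sum>j\<in>{- int n..int n}. a2 n j)"
            unfolding S1 S2 using Wm by simp
          finally show ?case using n by (simp add: m_def)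
        qed
      qed
    qed
  qed
qed

theorem mainTheorem1:
  fixes k :: nat and I :: "nat set"
  assumes "k \<ge> 2" and "I \<noteq> {}" and "I \<subseteq> {1..k-1}"
  shows "\<exists>rstar::real. rstar > 0 \<and> (\<exists>\<delta>::real. 0 < \<delta> \<and> \<delta> < 1 \<and>
    (\<forall>r::real. 0 < r \<and> r < rstar \<longrightarrow>
      (\<exists>L::real. L > 0 \<and>
        ((\<lambda>n::nat.
            (measure_pmf.expectation (random_instance k (nat \<lfloor>r * real n\<rfloor>) n)
               (\<lambda>F. real (num_delta_solutions I \<delta> n F)))\<^sup>2
          / measure_pmf.expectation (random_instance k (nat \<lfloor>r * real n\<rfloor>) n)
               (\<lambda>F. (real (num_delta_solutions I \<delta> n F))\<^sup>2))
         \<longlongrightarrow> L) sequentially)))"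
proof -
  obtain i where i: "i \<in> I" "i \<le> k" using assms(2,3) by fastforce
  \<comment> \<open>As \<open>I\<close> excludes 0 and \<open>k\<close>, constraints with all
    coordinates equal are violated; this forces the satisfaction probability to vanish at both
    ends.\<close>
  have f: "member_ind I 0 = 0" "member_ind I k = 0" "member_ind I i > 0" "\<And>i. member_ind I i \<ge> 0"
    using assms(1,3) i(1) by (auto simp: member_ind_def)
  obtain \<delta> where \<delta>: "0 < \<delta>" "\<delta> < 1" "(avg \<delta> ^^ (k - 1)) (fdiff (member_ind I)) 0 = 0"
    using exists_critical_point[OF f(4,1,2) i(2) f(3)] by blast
  have "(avg x ^^ k) (member_ind I) 0 > 0" if "0 < x" "x < 1" for x
    using funpow_avg_pos[OF f(4) that i(2), where a = 0] f(3) by simp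
  from moment_ratio_tendsto[OF \<delta>(1,2) assms(1) \<delta>(3) this] show ?thesis
    using \<delta>(1,2) by blast
qed

end
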